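(* Let $k\ge1$ be an integer and $P$ a fixed polynomial with real coefficients. (i) Suppose $y=T^{\theta_k}$ with fixed $0<\theta_k<\frac1{2k}$. Then, for each integer $\nu$ with $2\le\nu\le k$, there is $\varepsilon>0$ such that $$\mathcal I_{k,\nu}(\alpha_1,\alpha_2)=O(T^{1-\varepsilon})$$ as $T\to\infty$, uniformly for complex shifts $\alpha_1,\alpha_2\ll1/\log T$. (ii) Suppose $y=T^{\vartheta_k}$ with fixed $0<\vartheta_k<\frac1{4k}$. Then, for each integer $\nu$ with $3\le\nu\le k$, there is $\varepsilon>0$ such that $$\mathcal J_{k,\nu}(\alpha_1,\alpha_2,\alpha_3,\alpha_4)=O(T^{1-\varepsilon})$$ as $T\to\infty$, uniformly for complex shifts $\alpha_1,\alpha_2,\alpha_3,\alpha_4\ll1/\log T$.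
   Context: $\zeta$ is the Riemann zeta function and $\chi$ is the factor in its functional equation $\zeta(s)=\chi(s)\zeta(1-s)$. For $1\le n\le y$ put $P[n]=P\left(\frac{\log(y/n)}{\log y}\right)$, and let $A(s)=\sum_{n\le y}P[n]n^{-s}$. $\Phi$ is a smooth weight (possibly depending on $T$) with $0\le\Phi\le1$, with $\Phi$ supported in $[1/4,2]$, and with $\frac{d^j}{dt^j}\left[\Phi(t/T)\right]\ll_j(T/\log T)^{-j}$ for every integer $j\ge0$. Define $$\mathcal I_{k,\nu}(\alpha_1,\alpha_2)=\int_{-\infty}^{\infty}\zeta(\tfrac12+\alpha_1+it)\zeta(\tfrac12+\alpha_2-it)|A(\tfrac12+it)|^{2k-2\nu}A(\tfrac12+it)^{2\nu}\chi(\tfrac12-it)^\nu\,\Phi(\tfrac tT)\,dt,$$ $$\begin{aligned}\mathcal J_{k,\nu}(\alpha_1,\alpha_2,\alpha_3,\alpha_4)=\int_{-\infty}^{\infty}&\zeta(\tfrac12+\alpha_1+it)\zeta(\tfrac12+\alpha_2+it)\zeta(\tfrac12+\alpha_3-it)\zeta(\tfrac12+\alpha_4-it)\\&\times|A(\tfrac12+it)|^{2k-2\nu}A(\tfrac12+it)^{2\nu}\chi(\tfrac12-it)^\nu\,\Phi(\tfrac tT)\,dt.\end{aligned}$$ *)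

theory Defs
  imports "HOL-Complex_Analysis.Complex_Analysis" "HOL-Computational_Algebra.Polynomial"
begin

definition is_zeta_continuation :: "(complex \<Rightarrow> complex) \<Rightarrow> bool" where
  "is_zeta_continuation f \<longleftrightarrow>
     f holomorphic_on (- {1}) \<and>
     (\<forall>s. 1 < Re s \<longrightarrow> (\<lambda>n. of_nat (Suc n) powr (- s)) sums f s) \<and>
     f 1 = 0"

text \<open>
  The value at the pole \<open>s = 1\<close> is an arbitrary convention; it is fixed only to make the
  function unique. Existence and uniqueness are proved in \<open>is_zeta_continuation_zeta\<close> below.
\<close>

definition zeta :: "complex \<Rightarrow> complex" where
  "zeta = (THE f. is_zeta_continuation f)"

lemma holomorphic_suminf_local:
  fixes f :: "nat \<Rightarrow> complex \<Rightarrow> complex"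
  assumes S: "open S" and f: "\<And>n. f n holomorphic_on S"
    and b: "\<And>x. x \<in> S \<Longrightarrow> \<exists>d h. 0 < d \<and> summable h \<and>
              (\<forall>\<^sub>F n in sequentially. \<forall>y\<in>ball x d \<inter> S. norm (f n y) \<le> h n)"
  obtains g where "g holomorphic_on S" "\<And>s. s \<in> S \<Longrightarrow> (\<lambda>n. f n s) sums g s"
proof -
  have "\<exists>g g'. \<forall>x \<in> S. ((\<lambda>n. f n x) sums g x) \<and> ((\<lambda>n. deriv (f n) x) sums g' x) \<and>
          (g has_field_derivative g' x) (at x)"
    by (rule series_and_derivative_comparison_local[OF S _ b])
       (use f S in \<open>auto intro: holomorphic_derivI\<close>)
  then obtain g g' where g: "\<forall>x \<in> S. ((\<lambda>n. f n x) sums g x) \<and> (g has_field_derivative g' x) (at x)"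
    by blast
  then have "g holomorphic_on S"
    using S holomorphic_on_open by blast
  with g that show thesis by blast
qed

lemma norm_gchoose_le:
  fixes a :: complex
  assumes "norm a + 1 \<le> B"
  shows "norm (a gchoose k) \<le> B ^ k"
proof (induction k)
  case (Suc k)
  have B: "B \<ge> 1" using assms norm_ge_zero[of a] by linarith
  have eq: "a gchoose Suc k = (a gchoose k) * ((a - of_nat k) / of_nat (Suc k))"
    by (simp add: gbinomial_prod_rev mult.commute)
  have "norm (a - of_nat k) \<le> norm a + real k"
    by (metis norm_of_nat norm_triangle_ineq4)
  also have "\<dots> \<le> B * real (Suc k)"
  proof -
    have "1 * real k \<le> B * real k" using B by (intro mult_right_mono) auto
    then show ?thesis using assms by (simp add: algebra_simps)
  qed
  finally have "norm ((a - of_nat k) / of_nat (Suc k) :: complex) \<le> B"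
    unfolding norm_divide norm_of_nat by (subst pos_divide_le_eq) auto
  then show ?case
    unfolding eq norm_mult power_Suc2 using Suc B by (intro mult_mono) auto
qed auto

lemma binomial_remainder_bound:
  fixes a :: complex and n :: nat
  assumes B: "norm a + 1 \<le> B" and n: "2 * B \<le> real n"
  shows "norm (of_nat (Suc n) powr a - (\<Sum>k\<le>M. (a gchoose k) * of_nat n powr (a - of_nat k)))
           \<le> 2 * B ^ Suc M * real n powr (Re a - real (Suc M))"
proof -
  define u where "u = (\<lambda>k. (a gchoose k) * of_nat n powr (a - of_nat k))"
  define c where "c = B ^ Suc M * real n powr (Re a - real (Suc M))"
  have B1: "B \<ge> 1" using B norm_ge_zero[of a] by linarith
  have n0: "n > 0" using B1 n by (cases n) auto
  have "u sums of_real (1 + real n) powr a"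
    using gen_binomial_complex'[of 1 "real n" a] B1 n by (simp add: u_def)
  then have u: "u sums of_nat (Suc n) powr a" by simp
  have tail: "(\<lambda>k. u (k + Suc M)) sums (of_nat (Suc n) powr a - (\<Sum>k\<le>M. u k))"
    using sums_split_initial_segment[OF u, of "Suc M"] by (simp add: lessThan_Suc_atMost)
  have bnd: "norm (u (k + Suc M)) \<le> c * (1/2) ^ k" for k
  proof -
    have "norm (u (k + Suc M)) \<le> B ^ (k + Suc M) * real n powr (Re a - real (k + Suc M))"
      unfolding u_def norm_mult using n0
      by (intro mult_mono norm_gchoose_le B) (use B1 in \<open>auto simp: norm_powr_real_powr\<close>)
    also have "real n powr (Re a - real (k + Suc M)) = real n powr (Re a - real (Suc M)) / real n ^ k"
      using n0 by (simp add: powr_diff powr_add powr_realpow field_simps power_add)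
    also have "B ^ (k + Suc M) * (real n powr (Re a - real (Suc M)) / real n ^ k) = c * (B / real n) ^ k"
      by (simp add: c_def power_add power_divide field_simps)
    also have "\<dots> \<le> c * (1/2) ^ k"
      using n n0 B1 by (intro mult_left_mono power_mono) (auto simp: c_def field_simps)
    finally show ?thesis .
  qed
  have geo: "(\<lambda>k. c * (1/2) ^ k) sums (c * 2)"
    using sums_mult[OF geometric_sums[of "1/2::real"], of c] by simp
  have "norm (\<Sum>k. u (k + Suc M)) \<le> (\<Sum>k. c * (1/2) ^ k)"
    by (rule norm_suminf_le) (use bnd geo sums_summable in auto)
  then show ?thesis
    using sums_unique[OF tail] sums_unique[OF geo] by (simp add: u_def c_def mult_ac)
qed

lemma sums_zeta_series:
  assumes "1 < Re s"
  shows "(\<lambda>n. of_nat (Suc n) powr (- s)) sums (\<Sum>n. of_nat (Suc n) powr (- s))"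
proof -
  have "summable (\<lambda>n. of_nat n powr (- s) :: complex)"
  proof (rule summable_norm_cancel)
    have "summable (\<lambda>n. real n powr (- Re s))"
      using assms by (subst summable_real_powr_iff) auto
    then show "summable (\<lambda>n. norm (of_nat n powr (- s) :: complex))"
      by (simp add: norm_powr_real_powr)
  qed
  then have "summable (\<lambda>n. of_nat (Suc n) powr (- s) :: complex)"
    by (subst summable_Suc_iff)
  then show ?thesis by (rule summable_sums)
qed

lemma zeta_remainder_holomorphic:
  obtains E where "E holomorphic_on {s. 1 - real M < Re s}"
    "\<And>s. 1 - real M < Re s \<Longrightarrow>
       (\<lambda>n. of_nat (Suc (Suc n)) powr (1 - s)
          - (\<Sum>k\<le>M. ((1 - s) gchoose k) * of_nat (Suc n) powr (1 - s - of_nat k))) sums E s"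
proof (rule holomorphic_suminf_local[of "{s. 1 - real M < Re s}"
   "\<lambda>n s. of_nat (Suc (Suc n)) powr (1 - s)
          - (\<Sum>k\<le>M. ((1 - s) gchoose k) * of_nat (Suc n) powr (1 - s - of_nat k))"])
  show "open {s. 1 - real M < Re s}" by (rule open_halfspace_Re_gt)
next
  fix n
  show "(\<lambda>s. of_nat (Suc (Suc n)) powr (1 - s)
          - (\<Sum>k\<le>M. ((1 - s) gchoose k) * of_nat (Suc n) powr (1 - s - of_nat k)))
        holomorphic_on {s. 1 - real M < Re s}"
    unfolding gbinomial_prod_rev by (intro holomorphic_intros) (auto simp del: of_nat_Suc)
next
  fix x :: complex assume "x \<in> {s. 1 - real M < Re s}"
  then have x: "1 - real M < Re x" by simp
  define d where "d = (Re x + real M - 1) / 2"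
  define B where "B = norm (1 - x) + d + 1"
  define h where "h = (\<lambda>n. 2 * B ^ Suc M * real (Suc n) powr (d - Re x - real M))"
  have d: "d > 0" using x by (simp add: d_def)
  have "d - Re x - real M < -1" using x by (simp add: d_def field_simps)
  then have "summable (\<lambda>n. real n powr (d - Re x - real M))"
    by (subst summable_real_powr_iff)
  then have "summable h"
    unfolding h_def by (intro summable_mult) (subst summable_Suc_iff)
  moreover have "\<forall>\<^sub>F n in sequentially. \<forall>y\<in>ball x d \<inter> {s. 1 - real M < Re s}.
      norm (of_nat (Suc (Suc n)) powr (1 - y)
          - (\<Sum>k\<le>M. ((1 - y) gchoose k) * of_nat (Suc n) powr (1 - y - of_nat k))) \<le> h n"
  proof (rule eventually_mono[OF eventually_ge_at_top[of "nat \<lceil>2 * B\<rceil>"]], intro ballI)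
    fix n y assume n: "nat \<lceil>2 * B\<rceil> \<le> n" and y: "y \<in> ball x d \<inter> {s. 1 - real M < Re s}"
    have n': "2 * B \<le> real (Suc n)" using n by linarith
    have nxy: "norm (x - y) < d" using y by (simp add: dist_norm)
    have "norm (1 - y) \<le> norm (1 - x) + norm (x - y)"
      using norm_triangle_ineq[of "1 - x" "x - y"] by simp
    then have B: "norm (1 - y) + 1 \<le> B" using nxy by (simp add: B_def)
    have B0: "B \<ge> 0" using d by (simp add: B_def)
    have "Re x - Re y < d" using nxy abs_Re_le_cmod[of "x - y"] by auto
    then have "real (Suc n) powr (Re (1 - y) - real (Suc M)) \<le> real (Suc n) powr (d - Re x - real M)"
      by (intro powr_mono) auto
    then have "2 * B ^ Suc M * real (Suc n) powr (Re (1 - y) - real (Suc M)) \<le> h n"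
      unfolding h_def using B0 by (intro mult_left_mono) auto
    then show "norm (of_nat (Suc (Suc n)) powr (1 - y)
          - (\<Sum>k\<le>M. ((1 - y) gchoose k) * of_nat (Suc n) powr (1 - y - of_nat k))) \<le> h n"
      using binomial_remainder_bound[OF B n', of M] by linarith
  qed
  ultimately show "\<exists>d h. 0 < d \<and> summable h \<and>
      (\<forall>\<^sub>F n in sequentially. \<forall>y\<in>ball x d \<inter> {s. 1 - real M < Re s}.
      norm (of_nat (Suc (Suc n)) powr (1 - y)
          - (\<Sum>k\<le>M. ((1 - y) gchoose k) * of_nat (Suc n) powr (1 - y - of_nat k))) \<le> h n)"
    using d by blast
qed (use that in auto)

lemma zeta_continuation_step:
  assumes M: "M \<ge> 1"
    and g: "M \<ge> 2 \<Longrightarrow> g holomorphic_on {s. 2 - real M < Re s}"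
    and geq: "\<And>s. 1 < Re s \<Longrightarrow> M \<ge> 2 \<Longrightarrow> g s = (s - 1) * (\<Sum>n. of_nat (Suc n) powr (- s))"
  shows "\<exists>g'. g' holomorphic_on {s. 1 - real M < Re s} \<and>
           (\<forall>s. 1 < Re s \<longrightarrow> g' s = (s - 1) * (\<Sum>n. of_nat (Suc n) powr (- s)))"
proof -
  define D :: "complex \<Rightarrow> complex" where "D = (\<lambda>s. \<Sum>n. of_nat (Suc n) powr (- s))"
  obtain E where E: "E holomorphic_on {s. 1 - real M < Re s}"
    and E_sums: "\<And>s. 1 - real M < Re s \<Longrightarrow>
       (\<lambda>n. of_nat (Suc (Suc n)) powr (1 - s)
          - (\<Sum>k\<le>M. ((1 - s) gchoose k) * of_nat (Suc n) powr (1 - s - of_nat k))) sums E s"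
    by (rule zeta_remainder_holomorphic[of M]) blast
  define g' where "g' = (\<lambda>s. E s + 1 - (\<Sum>k\<in>{2..M}. ((1 - s) gchoose (k - 1)) / of_nat k * g (s + of_nat k - 1)))"
  have hol: "g' holomorphic_on {s. 1 - real M < Re s}"
  proof -
    have 1: "(\<lambda>s. g (s + of_nat k - 1)) holomorphic_on {s. 1 - real M < Re s}" if "k \<in> {2..M}" for k
    proof -
      have "M \<ge> 2" using that by auto
      from g[OF this] have "(g \<circ> (\<lambda>s. s + of_nat k - 1)) holomorphic_on {s. 1 - real M < Re s}"
        by (rule holomorphic_on_compose_gen[rotated]) (use that in \<open>auto intro!: holomorphic_intros\<close>)
      then show ?thesis by (simp add: o_def)
    qed
    show ?thesis
      unfolding g'_def gbinomial_prod_rev by (intro holomorphic_intros E 1) auto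
  qed
  have eq: "g' s = (s - 1) * D s" if s: "1 < Re s" for s
  proof -
    have s1: "1 - real M < Re s" using s M by simp
    have pw: "((1 - s) gchoose k) * of_nat (Suc n) powr (1 - s - of_nat k)
              = ((1 - s) gchoose k) * of_nat (Suc n) powr (- (s + of_nat k - 1))" for k n
      by (simp add: algebra_simps)
    have t1: "(\<lambda>n. \<Sum>k\<in>{1..M}. ((1 - s) gchoose k) * of_nat (Suc n) powr (1 - s - of_nat k)) sums
              (\<Sum>k\<in>{1..M}. ((1 - s) gchoose k) * D (s + of_nat k - 1))"
      unfolding pw D_def by (intro sums_sum sums_mult sums_zeta_series) (use s in auto)
    have lim: "(\<lambda>n. of_nat (Suc n) powr (1 - s) :: complex) \<longlonglongrightarrow> 0"
    proof (rule tendsto_norm_zero_cancel)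
      have "((\<lambda>n. real (Suc n) powr (1 - Re s)) \<longlongrightarrow> 0) sequentially"
        by (rule tendsto_neg_powr) (use s filterlim_compose[OF filterlim_real_sequentially filterlim_Suc] in \<open>auto simp del: of_nat_Suc\<close>)
      then show "(\<lambda>n. norm (of_nat (Suc n) powr (1 - s) :: complex)) \<longlonglongrightarrow> 0"
        by (simp add: norm_powr_real_powr del: of_nat_Suc)
    qed
    have t2: "(\<lambda>n. of_nat (Suc (Suc n)) powr (1 - s) - of_nat (Suc n) powr (1 - s)) sums (0 - 1 :: complex)"
      using telescope_sums[OF lim] by simp
    have split: "(\<Sum>k\<le>M. f k) = f 0 + (\<Sum>k\<in>{1..M}. f k)" for f :: "nat \<Rightarrow> complex"
      by (simp add: atMost_atLeast0 sum.atLeast_Suc_atMost)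
    have "(\<lambda>n. of_nat (Suc (Suc n)) powr (1 - s)
          - (\<Sum>k\<le>M. ((1 - s) gchoose k) * of_nat (Suc n) powr (1 - s - of_nat k))) sums
          (0 - 1 - (\<Sum>k\<in>{1..M}. ((1 - s) gchoose k) * D (s + of_nat k - 1)))"
      using sums_diff[OF t2 t1] unfolding split by (simp add: algebra_simps)
    with E_sums[OF s1] have Es: "E s = - 1 - (\<Sum>k\<in>{1..M}. ((1 - s) gchoose k) * D (s + of_nat k - 1))"
      using sums_unique2 by fastforce
    have "(\<Sum>k\<in>{1..M}. ((1 - s) gchoose k) * D (s + of_nat k - 1))
           = (1 - s) * D s + (\<Sum>k\<in>{2..M}. ((1 - s) gchoose k) * D (s + of_nat k - 1))"
      using M by (simp add: sum.atLeast_Suc_atMost numeral_2_eq_2)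
    also have "(\<Sum>k\<in>{2..M}. ((1 - s) gchoose k) * D (s + of_nat k - 1))
             = - (\<Sum>k\<in>{2..M}. ((1 - s) gchoose (k - 1)) / of_nat k * g (s + of_nat k - 1))"
      unfolding sum_negf[symmetric]
    proof (rule sum.cong)
      fix k assume k: "k \<in> {2..M}"
      then obtain j where j: "k = Suc j" by (cases k) auto
      have gk: "g (s + of_nat k - 1) = (s + of_nat k - 2) * D (s + of_nat k - 1)"
        unfolding D_def by (subst geq) (use k s in \<open>auto simp: algebra_simps\<close>)
      have "(1 - s) gchoose k = ((1 - s) gchoose j) * ((1 - s - of_nat j) / of_nat k)"
        unfolding j by (simp add: gbinomial_prod_rev mult.commute)
      also have "\<dots> = - (((1 - s) gchoose (k - 1)) / of_nat k * (s + of_nat k - 2))"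
        unfolding j by (simp add: field_simps del: of_nat_Suc) (simp add: algebra_simps)
      finally show "((1 - s) gchoose k) * D (s + of_nat k - 1) =
          - (((1 - s) gchoose (k - 1)) / of_nat k * g (s + of_nat k - 1))"
        unfolding gk by simp
    qed auto
    finally show ?thesis unfolding g'_def Es by (simp add: algebra_simps)
  qed
  show ?thesis using hol eq unfolding D_def by blast
qed

lemma connected_halfplane: "connected {s. c < Re s}"
  by (intro convex_connected convex_halfspace_Re_gt)

lemma zeta_continuation_halfplane:
  "\<exists>g. g holomorphic_on {s. - real N < Re s} \<and>
       (\<forall>s. 1 < Re s \<longrightarrow> g s = (s - 1) * (\<Sum>n. of_nat (Suc n) powr (- s)))"
proof (induction N)
  case 0
  show ?case using zeta_continuation_step[of 1 undefined] by simp
next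
  case (Suc N)
  then obtain g where g: "g holomorphic_on {s. - real N < Re s}"
    "\<forall>s. 1 < Re s \<longrightarrow> g s = (s - 1) * (\<Sum>n. of_nat (Suc n) powr (- s))" by blast
  then show ?case
    using zeta_continuation_step[of "Suc (Suc N)" g] by (simp add: algebra_simps)
qed

lemma ex_zeta_continuation: "\<exists>f. is_zeta_continuation f"
proof -
  define D :: "complex \<Rightarrow> complex" where "D = (\<lambda>s. \<Sum>n. of_nat (Suc n) powr (- s))"
  obtain g where g: "\<And>N. g N holomorphic_on {s. - real N < Re s}"
    and gD: "\<And>N s. 1 < Re s \<Longrightarrow> g N s = (s - 1) * D s"
    using zeta_continuation_halfplane unfolding D_def by metis
  have agree: "g N s = g M s" if "N \<le> M" "- real N < Re s" for N M s
  proof (rule analytic_continuation_open[of "{s. 1 < Re s}" "{s. - real N < Re s}" "g N" "g M"])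
    show "{s. 1 < Re s} \<noteq> {}" by (auto intro: exI[of _ 2])
    show "g M holomorphic_on {s. - real N < Re s}"
      by (rule holomorphic_on_subset[OF g]) (use that in auto)
  qed (use that gD g in \<open>auto simp: open_halfspace_Re_gt connected_halfplane\<close>)
  define G where "G = (\<lambda>s. g (nat (\<lceil>- Re s\<rceil> + 1)) s)"
  have Gg: "G s = g N s" if "- real N < Re s" for N s
  proof -
    have "- real (nat (\<lceil>- Re s\<rceil> + 1)) < Re s" by linarith
    then show ?thesis unfolding G_def using agree that by (metis nle_le)
  qed
  have "G holomorphic_on (\<Union>N. {s. - real N < Re s})"
  proof (rule holomorphic_on_UN_open)
    fix N
    show "G holomorphic_on {s. - real N < Re s}"
      using g[of N] by (rule holomorphic_transform) (simp add: Gg)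
  qed (auto simp: open_halfspace_Re_gt)
  moreover have "(\<Union>N. {s. - real N < Re s}) = UNIV"
  proof -
    have "\<exists>N. - real N < Re s" for s
      by (rule exI[of _ "nat (\<lceil>- Re s\<rceil> + 1)"]) linarith
    then show ?thesis by auto
  qed
  ultimately have G: "G holomorphic_on UNIV" by simp
  define f where "f = (\<lambda>s. if s = 1 then 0 else G s / (s - 1))"
  have "(\<lambda>s. G s / (s - 1)) holomorphic_on - {1}"
    by (intro holomorphic_intros holomorphic_on_subset[OF G]) auto
  then have "f holomorphic_on - {1}"
    by (rule holomorphic_transform) (auto simp: f_def)
  moreover have "(\<lambda>n. of_nat (Suc n) powr (- s)) sums f s" if s: "1 < Re s" for s
  proof -
    have "s \<noteq> 1" using s by auto
    moreover have "G s = (s - 1) * D s" using Gg[of 0 s] gD[of s 0] s by simp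
    ultimately have "f s = D s" by (simp add: f_def)
    then show ?thesis using sums_zeta_series[OF s] by (simp add: D_def)
  qed
  ultimately show ?thesis unfolding is_zeta_continuation_def by (auto simp: f_def)
qed

lemma is_zeta_continuation_unique:
  assumes f: "is_zeta_continuation f" and g: "is_zeta_continuation g"
  shows "f = g"
proof
  fix s
  show "f s = g s"
  proof (cases "s = 1")
    case False
    show ?thesis
    proof (rule analytic_continuation_open[of "{s. 1 < Re s}" "- {1}" f g])
      show "{s. 1 < Re s} \<noteq> {}" by (auto intro: exI[of _ 2])
      show "connected (- {1::complex})"
        by (rule connected_punctured_universe) simp
      show "f z = g z" if "z \<in> {s. 1 < Re s}" for z
        using f g that sums_unique2 unfolding is_zeta_continuation_def by blast
    qed (use f g False in \<open>auto simp: is_zeta_continuation_def open_halfspace_Re_gt\<close>)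
  qed (use f g in \<open>auto simp: is_zeta_continuation_def\<close>)
qed

lemma is_zeta_continuation_zeta: "is_zeta_continuation zeta"
proof -
  have "\<exists>!f. is_zeta_continuation f"
    using ex_zeta_continuation is_zeta_continuation_unique by blast
  then show ?thesis unfolding zeta_def by (rule theI')
qed

text \<open>
  The factor \<open>\<chi>\<close> with \<open>\<zeta>(s) = \<chi>(s) \<zeta>(1 - s)\<close> as a meromorphic function, in closed form (the
  quotient \<open>\<zeta>(s) / \<zeta>(1 - s)\<close> would be ill-defined at the zeros of \<open>\<zeta>\<close> on the critical line).
\<close>

definition zeta_chi :: "complex \<Rightarrow> complex" where
  "zeta_chi s = 2 powr s * of_real pi powr (s - 1) * sin (of_real pi * s / 2) * Gamma (1 - s)"

definition poly_weight :: "real poly \<Rightarrow> real \<Rightarrow> nat \<Rightarrow> real" where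
  "poly_weight P y n = poly P (ln (y / real n) / ln y)"

definition dirichlet_poly :: "real poly \<Rightarrow> real \<Rightarrow> complex \<Rightarrow> complex" where
  "dirichlet_poly P y s =
     (\<Sum>n | 1 \<le> n \<and> real n \<le> y. of_real (poly_weight P y n) * of_nat n powr (- s))"

text \<open>
  The weight may depend on \<open>T\<close>: it is a family with \<open>\<Phi> T\<close> the weight used at height \<open>T\<close>.
  Only large \<open>T\<close> matter, and the constants \<open>C\<close> may depend on \<open>j\<close> but not on \<open>T\<close>.
\<close>

definition admissible_weight :: "(real \<Rightarrow> real \<Rightarrow> real) \<Rightarrow> bool" where
  "admissible_weight \<Phi> \<longleftrightarrow>
     (\<forall>\<^sub>F T in at_top. \<forall>x. 0 \<le> \<Phi> T x \<and> \<Phi> T x \<le> 1) \<and>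
     (\<forall>\<^sub>F T in at_top. closure {x. \<Phi> T x \<noteq> 0} \<subseteq> {1/4..2}) \<and>
     (\<forall>\<^sub>F T in at_top. \<forall>j x. (deriv ^^ j) (\<Phi> T) field_differentiable (at x)) \<and>
     (\<forall>j. \<exists>C. \<forall>\<^sub>F T in at_top. \<forall>t.
        \<bar>(deriv ^^ j) (\<lambda>u. \<Phi> T (u / T)) t\<bar> \<le> C * (T / ln T) powr (- real j))"

definition moment_I ::
  "nat \<Rightarrow> nat \<Rightarrow> real poly \<Rightarrow> real \<Rightarrow> (real \<Rightarrow> real) \<Rightarrow> real \<Rightarrow> complex \<Rightarrow> complex \<Rightarrow> complex" where
  "moment_I k \<nu> P y \<phi> T \<alpha>1 \<alpha>2 =
     (LBINT t. zeta (1/2 + \<alpha>1 + \<i> * of_real t) * zeta (1/2 + \<alpha>2 - \<i> * of_real t)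
        * of_real (norm (dirichlet_poly P y (1/2 + \<i> * of_real t)) ^ (2 * k - 2 * \<nu>))
        * dirichlet_poly P y (1/2 + \<i> * of_real t) ^ (2 * \<nu>)
        * zeta_chi (1/2 - \<i> * of_real t) ^ \<nu>
        * of_real (\<phi> (t / T)))"

definition moment_J ::
  "nat \<Rightarrow> nat \<Rightarrow> real poly \<Rightarrow> real \<Rightarrow> (real \<Rightarrow> real) \<Rightarrow> real \<Rightarrow>
     complex \<Rightarrow> complex \<Rightarrow> complex \<Rightarrow> complex \<Rightarrow> complex" where
  "moment_J k \<nu> P y \<phi> T \<alpha>1 \<alpha>2 \<alpha>3 \<alpha>4 =
     (LBINT t. zeta (1/2 + \<alpha>1 + \<i> * of_real t) * zeta (1/2 + \<alpha>2 + \<i> * of_real t)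
        * zeta (1/2 + \<alpha>3 - \<i> * of_real t) * zeta (1/2 + \<alpha>4 - \<i> * of_real t)
        * of_real (norm (dirichlet_poly P y (1/2 + \<i> * of_real t)) ^ (2 * k - 2 * \<nu>))
        * dirichlet_poly P y (1/2 + \<i> * of_real t) ^ (2 * \<nu>)
        * zeta_chi (1/2 - \<i> * of_real t) ^ \<nu>
        * of_real (\<phi> (t / T)))"

end

theory Submission
  imports Defs
begin

text \<open>
  On the critical line the integrand is the restriction of a function \<open>G\<close> holomorphic in the upper
  half-plane: \<open>\<bar>A\<bar>\<close> is removed through \<open>cnj (A s) = A (1 - s)\<close>. On \<open>Re s = 1/2 - n\<close> the factor
  \<open>\<chi> (1 - s)\<^sup>\<nu>\<close> saves \<open>T\<close> to the power \<open>n \<nu>\<close>, whereas \<open>r\<close> factors \<open>\<zeta> (s + a)\<close> and the Dirichlet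
  polynomials lose only \<open>n (r + 2 k \<theta>) + O(1)\<close>, with \<open>r = 1\<close> for the first moment and \<open>r = 2\<close> for the
  second. Since \<open>r + 1 \<le> \<nu>\<close> and \<open>2 k \<theta> < 1\<close>, \<open>G\<close> is as small as desired there once \<open>n\<close> is large.
  Between the two lines a crude polynomial bound for \<open>G\<close> suffices, because the smooth weight allows
  arbitrarily many integrations by parts. No functional equation or approximate functional
  equation for \<open>\<zeta>\<close> is needed: a bound for \<open>\<zeta> s\<close> by \<open>\<bar>s\<bar>\<close> to the power \<open>O(1) - Re s\<close> is enough.
\<close>

section \<open>Polynomial bounds for the zeta function\<close>

text \<open>Taylor's theorem for \<open>z powr a\<close> on the ray to the right of
  \<open>n\<close>. The condition on \<open>Re a\<close> makes the modulus of the last derivative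
  largest at the left end. In contrast to \<open>binomial_remainder_bound\<close>, \<open>n\<close>
  need not be large compared with \<open>a\<close>, so summation over all \<open>n\<close> gives a
  bound polynomial in \<open>a\<close>.\<close>

lemma norm_powr_taylor_remainder_le:
  fixes a :: complex
  assumes n: "n \<ge> 1" and a: "Re a \<le> real (Suc M)"
  shows "norm (of_nat (Suc n) powr a - (\<Sum>k\<le>M. (a gchoose k) * of_nat n powr (a - of_nat k)))
           \<le> real (Suc M) * norm (a gchoose Suc M) * real n powr (Re a - real (Suc M))"
proof -
  define S where "S = {z. real n \<le> Re z \<and> Im z = 0}"
  \<comment> \<open>\<open>f i\<close> is the \<open>i\<close>-th derivative of
    \<open>z powr a\<close>; \<open>fact i * (a gchoose i)\<close> is the falling factorial.\<close>
  define f where "f = (\<lambda>i z. fact i * (a gchoose i) * z powr (a - of_nat i))"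
  have choose: "fact (Suc i) * (a gchoose Suc i) = fact i * (a gchoose i) * (a - of_nat i)" for i
    using of_nat_neq_0[of i, where 'a=complex] by (simp add: gbinomial_prod_rev mult_ac)
  have "convex S"
    unfolding S_def convex_alt
  proof (intro ballI allI impI)
    fix x y u
    assume *: "x \<in> {z. real n \<le> Re z \<and> Im z = 0}" "y \<in> {z. real n \<le> Re z \<and> Im z = 0}" "0 \<le> u \<and> u \<le> (1::real)"
    have "(1 - u) * real n + u * real n \<le> (1 - u) * Re x + u * Re y"
      using * by (intro add_mono mult_left_mono) auto
    then show "(1 - u) *\<^sub>R x + u *\<^sub>R y \<in> {z. real n \<le> Re z \<and> Im z = 0}"
      using * by (simp add: algebra_simps)
  qed
  moreover have "(f i has_field_derivative f (Suc i) z) (at z within S)" if "z \<in> S" for i z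
  proof -
    have "z \<notin> \<real>\<^sub>\<le>\<^sub>0" using that n by (auto simp: S_def complex_nonpos_Reals_iff)
    then have "((\<lambda>z. fact i * (a gchoose i) * z powr (a - of_nat i)) has_field_derivative
        fact i * (a gchoose i) * ((a - of_nat i) * z powr (a - of_nat i - 1))) (at z within S)"
      by (auto intro!: derivative_eq_intros)
    then show ?thesis
      unfolding f_def choose by (simp add: algebra_simps)
  qed
  moreover have "norm (f (Suc M) z) \<le> fact (Suc M) * norm (a gchoose Suc M) * real n powr (Re a - real (Suc M))"
    if "z \<in> S" for z
  proof -
    have "norm (z powr (a - of_nat (Suc M))) = Re z powr (Re a - real (Suc M))"
      using that n by (subst norm_powr_real_powr) (auto simp: S_def complex_is_Real_iff)
    also have "\<dots> \<le> real n powr (Re a - real (Suc M))"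
      using that n a by (intro powr_mono2') (auto simp: S_def)
    finally show ?thesis
      unfolding f_def norm_mult norm_fact by (intro mult_left_mono) auto
  qed
  ultimately have "norm (f 0 (of_nat (Suc n)) - (\<Sum>i\<le>M. f i (of_nat n) * (of_nat (Suc n) - of_nat n) ^ i / fact i))
      \<le> fact (Suc M) * norm (a gchoose Suc M) * real n powr (Re a - real (Suc M)) *
         norm (of_nat (Suc n) - of_nat n :: complex) ^ Suc M / fact M"
    by (intro complex_Taylor[of S]) (auto simp: S_def)
  moreover have "fact (Suc M) * x * y * norm (of_nat (Suc n) - of_nat n :: complex) ^ Suc M / fact M
      = real (Suc M) * x * y" for x y :: real
    by simp
  moreover have "(\<Sum>i\<le>M. f i (of_nat n) * (of_nat (Suc n) - of_nat n) ^ i / fact i)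
      = (\<Sum>k\<le>M. (a gchoose k) * of_nat n powr (a - of_nat k))"
    by (simp add: f_def)
  ultimately show ?thesis by (simp add: f_def)
qed

lemma zeta_holomorphic: "zeta holomorphic_on - {1}"
  and zeta_sums: "1 < Re s \<Longrightarrow> (\<lambda>n. of_nat (Suc n) powr (- s)) sums zeta s"
  using is_zeta_continuation_zeta unfolding is_zeta_continuation_def by auto

lemma norm_zeta_le:
  assumes "5/4 \<le> Re s"
  shows "norm (zeta s) \<le> (\<Sum>n. real (Suc n) powr (- (5/4)))"
proof -
  have "summable (\<lambda>n. real n powr (- (5/4)))" by (subst summable_real_powr_iff) auto
  then have s: "summable (\<lambda>n. real (Suc n) powr (- (5/4)))" by (subst summable_Suc_iff)
  have "norm (of_nat (Suc n) powr (- s)) \<le> real (Suc n) powr (- (5/4))" for n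
    using assms by (simp add: norm_powr_real_powr powr_mono)
  from norm_suminf_le[OF this s] show ?thesis
    using sums_unique[OF zeta_sums[of s]] assms by simp
qed

text \<open>
  For \<open>Re s > 1\<close> this is the telescoping sum of \<open>(n + 1) powr (1 - s) - n powr (1 - s)\<close> with the
  binomial expansion subtracted; the series still converges for \<open>Re s > 1 - M\<close>.
\<close>

lemma zeta_recurrence:
  assumes M: "M \<ge> 1" and s: "1 - real M < Re s" "Im s \<noteq> 0"
  shows "(\<lambda>n. of_nat (Suc (Suc n)) powr (1 - s)
           - (\<Sum>k\<le>M. ((1 - s) gchoose k) * of_nat (Suc n) powr (1 - s - of_nat k)))
         sums ((s - 1) * zeta s - 1 - (\<Sum>k\<in>{2..M}. ((1 - s) gchoose k) * zeta (s + of_nat k - 1)))"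
proof -
  obtain E where E: "E holomorphic_on {s. 1 - real M < Re s}"
    and E_sums: "\<And>s. 1 - real M < Re s \<Longrightarrow>
       (\<lambda>n. of_nat (Suc (Suc n)) powr (1 - s)
          - (\<Sum>k\<le>M. ((1 - s) gchoose k) * of_nat (Suc n) powr (1 - s - of_nat k))) sums E s"
    by (rule zeta_remainder_holomorphic[of M]) blast
  define R where "R = (\<lambda>s. (s - 1) * zeta s - 1 - (\<Sum>k\<in>{2..M}. ((1 - s) gchoose k) * zeta (s + of_nat k - 1)))"
  \<comment> \<open>The poles of all the translates of zeta are real. Keeping only the side of the
    real axis that contains \<open>s\<close> avoids them and leaves a convex, hence connected,
    domain.\<close>
  define U where "U = {z. 1 - real M < Re z} \<inter> {z. Im s * Im z > 0}"
  define V where "V = {z. 1 < Re z} \<inter> {z. Im s * Im z > 0}"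
  have half: "{z. Im s * Im z > 0} = (if Im s > 0 then {z. Im z > 0} else {z. Im z < 0})"
    using s by (auto simp: zero_less_mult_iff)
  have op: "open {z. Im s * Im z > 0}" "convex {z. Im s * Im z > 0}"
    unfolding half by (auto simp: open_halfspace_Im_gt open_halfspace_Im_lt convex_halfspace_Im_gt convex_halfspace_Im_lt)
  have "E s = R s"
  proof (rule analytic_continuation_open[of V U E R])
    show "open V" "open U"
      unfolding U_def V_def by (auto intro!: open_Int op open_halfspace_Re_gt)
    show "connected U"
      unfolding U_def by (intro convex_connected convex_Int op convex_halfspace_Re_gt)
    have "Complex 2 (Im s) \<in> V" using s by (auto simp: V_def zero_less_mult_iff)
    then show "V \<noteq> {}" by auto
    show "V \<subseteq> U" using M by (auto simp: U_def V_def)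
    show "s \<in> U" using s by (auto simp: U_def zero_less_mult_iff)
    show "E holomorphic_on U"
      using E by (rule holomorphic_on_subset) (auto simp: U_def)
    have z: "(\<lambda>z. zeta (z + of_real c)) holomorphic_on U" for c
    proof -
      have "(zeta \<circ> (\<lambda>z. z + of_real c)) holomorphic_on U"
      proof (rule holomorphic_on_compose_gen[OF _ zeta_holomorphic])
        show "(\<lambda>z. z + of_real c) ` U \<subseteq> - {1}"
          by (auto simp: U_def complex_eq_iff)
      qed (intro holomorphic_intros)
      then show ?thesis by (simp add: o_def)
    qed
    have "zeta holomorphic_on U" using z[of 0] by simp
    moreover have "(\<lambda>z. zeta (z + of_nat k - 1)) holomorphic_on U" for k
      using z[of "real k - 1"] by (simp add: algebra_simps)
    ultimately show "R holomorphic_on U"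
      unfolding R_def gbinomial_prod_rev by (intro holomorphic_intros) auto
    show "E z = R z" if "z \<in> V" for z
    proof -
      have z: "1 < Re z" using that by (simp add: V_def)
      have pw: "((1 - z) gchoose k) * of_nat (Suc n) powr (1 - z - of_nat k)
                = ((1 - z) gchoose k) * of_nat (Suc n) powr (- (z + of_nat k - 1))" for k n
        by (simp add: algebra_simps)
      have t1: "(\<lambda>n. \<Sum>k\<in>{1..M}. ((1 - z) gchoose k) * of_nat (Suc n) powr (1 - z - of_nat k)) sums
                (\<Sum>k\<in>{1..M}. ((1 - z) gchoose k) * zeta (z + of_nat k - 1))"
        unfolding pw by (intro sums_sum sums_mult zeta_sums) (use z in auto)
      have "(\<lambda>n. of_nat (Suc n) powr (1 - z) :: complex) \<longlonglongrightarrow> 0"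
      proof (rule tendsto_norm_zero_cancel)
        have "((\<lambda>n. real (Suc n) powr (1 - Re z)) \<longlongrightarrow> 0) sequentially"
          by (rule tendsto_neg_powr) (use z filterlim_compose[OF filterlim_real_sequentially filterlim_Suc] in \<open>auto simp del: of_nat_Suc\<close>)
        then show "(\<lambda>n. norm (of_nat (Suc n) powr (1 - z) :: complex)) \<longlonglongrightarrow> 0"
          by (simp add: norm_powr_real_powr del: of_nat_Suc)
      qed
      from telescope_sums[OF this]
      have t2: "(\<lambda>n. of_nat (Suc (Suc n)) powr (1 - z) - of_nat (Suc n) powr (1 - z)) sums (0 - 1 :: complex)"
        by simp
      have split: "(\<Sum>k\<le>M. f k) = f 0 + (\<Sum>k\<in>{1..M}. f k)" for f :: "nat \<Rightarrow> complex"
        by (simp add: atMost_atLeast0 sum.atLeast_Suc_atMost)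
      have "(\<lambda>n. of_nat (Suc (Suc n)) powr (1 - z)
            - (\<Sum>k\<le>M. ((1 - z) gchoose k) * of_nat (Suc n) powr (1 - z - of_nat k))) sums
            (0 - 1 - (\<Sum>k\<in>{1..M}. ((1 - z) gchoose k) * zeta (z + of_nat k - 1)))"
        using sums_diff[OF t2 t1] unfolding split by (simp add: algebra_simps)
      moreover have "1 - real M < Re z" using z M by simp
      ultimately have "E z = 0 - 1 - (\<Sum>k\<in>{1..M}. ((1 - z) gchoose k) * zeta (z + of_nat k - 1))"
        using E_sums sums_unique2 by blast
      also have "(\<Sum>k\<in>{1..M}. ((1 - z) gchoose k) * zeta (z + of_nat k - 1)) =
          (1 - z) * zeta z + (\<Sum>k\<in>{2..M}. ((1 - z) gchoose k) * zeta (z + of_nat k - 1))"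
        using M by (simp add: sum.atLeast_Suc_atMost numeral_2_eq_2)
      finally show ?thesis by (simp add: R_def algebra_simps)
    qed
  qed
  with E_sums[of s] s show ?thesis by (simp add: R_def)
qed

text \<open>Strong induction with \<open>zeta_recurrence\<close> for \<open>M = N + 1\<close>, which
  expresses \<open>(s - 1) * zeta s\<close> through values of zeta further right. With
  \<open>B = norm s + 2\<close>, the binomial coefficient costs \<open>B ^ k\<close> while moving
  right by \<open>k - 1\<close> lowers the inductive exponent by \<open>k - 1\<close>, so each term
  has size \<open>B ^ (N + 3)\<close>. Division by \<open>s - 1\<close> removes one power.\<close>

lemma zeta_polynomial_bound:
  "\<exists>C\<ge>0. \<forall>s. 5/4 - real N \<le> Re s \<and> 1 \<le> \<bar>Im s\<bar> \<longrightarrow> norm (zeta s) \<le> C * (norm s + 2) ^ (N + 2)"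
proof (induction N rule: less_induct)
  case (less N)
  show ?case
  proof (cases "N = 0")
    case True
    define C where "C = (\<Sum>n. real (Suc n) powr (- (5/4)))"
    have "norm (zeta s) \<le> C * (norm s + 2) ^ (N + 2)" if "5/4 - real N \<le> Re s" for s
    proof -
      have "norm (zeta s) \<le> C" using norm_zeta_le[of s] that True by (simp add: C_def)
      moreover have "C * 1 \<le> C * (norm s + 2) ^ (N + 2)"
        using order_trans[OF norm_ge_zero \<open>norm (zeta s) \<le> C\<close>]
        by (intro mult_left_mono one_le_power) (auto intro: add_increasing)
      ultimately show ?thesis by simp
    qed
    moreover have "C \<ge> 0" using order_trans[OF norm_ge_zero norm_zeta_le[of 2]] by (simp add: C_def)
    ultimately show ?thesis by blast
  next
    case False
    have "\<exists>C\<ge>0. \<forall>s. 5/4 - real (N - j) \<le> Re s \<and> 1 \<le> \<bar>Im s\<bar> \<longrightarrow>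
        norm (zeta s) \<le> C * (norm s + 2) ^ (N - j + 2)" if "j \<in> {1..N}" for j
      by (rule less) (use that in auto)
    then obtain C where C: "\<And>j. j \<in> {1..N} \<Longrightarrow> C j \<ge> 0"
      "\<And>j s. j \<in> {1..N} \<Longrightarrow> 5/4 - real (N - j) \<le> Re s \<Longrightarrow> 1 \<le> \<bar>Im s\<bar> \<Longrightarrow>
        norm (zeta s) \<le> C j * (norm s + 2) ^ (N - j + 2)"
      by metis
    define M where "M = N + 1"
    define S where "S = (\<Sum>n. real (Suc n) powr (- (5/4)))"
    have "summable (\<lambda>n. real n powr (- (5/4)))" by (subst summable_real_powr_iff) auto
    then have S: "summable (\<lambda>n. real (Suc n) powr (- (5/4)))" by (subst summable_Suc_iff)
    have S0: "S \<ge> 0" unfolding S_def by (intro suminf_nonneg S) auto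
    \<comment> \<open>The factor 4 pays for \<open>B / 4 \<le> norm (s - 1)\<close> at the end; the
      powers of \<open>Suc M\<close> pay for replacing \<open>s\<close> by its translates
      \<open>s + k - 1\<close>.\<close>
    define K where "K = 4 * (1 + real (Suc M) * S + (\<Sum>k\<in>{2..M}. C (k - 1) * real (Suc M) ^ (N + 2)))"
    have "C (k - 1) \<ge> 0" if "k \<in> {2..M}" for k
    proof -
      have "k - 1 \<in> {1..N}" using that unfolding M_def atLeastAtMost_iff by linarith
      then show ?thesis by (rule C(1))
    qed
    then have K0: "K \<ge> 0"
      unfolding K_def using S0
      by (intro mult_nonneg_nonneg add_nonneg_nonneg sum_nonneg) auto
    have "norm (zeta s) \<le> K * (norm s + 2) ^ (N + 2)"
      if s: "5/4 - real N \<le> Re s" "1 \<le> \<bar>Im s\<bar>" for s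
    proof -
      define B where "B = norm s + 2"
      have B: "B \<ge> 1" "norm (1 - s) + 1 \<le> B"
        using norm_triangle_ineq4[of 1 s] by (auto simp: B_def)
      have pos: "1 - real M < Re s" "Im s \<noteq> 0" using s by (auto simp: M_def)
      define r where "r = (\<lambda>n. of_nat (Suc (Suc n)) powr (1 - s)
           - (\<Sum>k\<le>M. ((1 - s) gchoose k) * of_nat (Suc n) powr (1 - s - of_nat k)))"
      define Sig where "Sig = (\<Sum>k\<in>{2..M}. ((1 - s) gchoose k) * zeta (s + of_nat k - 1))"
      have rs: "r sums ((s - 1) * zeta s - 1 - Sig)"
        unfolding r_def Sig_def by (rule zeta_recurrence) (use pos in \<open>auto simp: M_def\<close>)
      have r: "norm (r n) \<le> real (Suc M) * B ^ (Suc M) * real (Suc n) powr (- (5/4))" for n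
      proof -
        have "norm (r n) \<le> real (Suc M) * norm ((1 - s) gchoose Suc M) * real (Suc n) powr (Re (1 - s) - real (Suc M))"
          unfolding r_def by (rule norm_powr_taylor_remainder_le) (use s in \<open>auto simp: M_def\<close>)
        also have "\<dots> \<le> real (Suc M) * B ^ (Suc M) * real (Suc n) powr (- (5/4))"
          using s B by (intro mult_mono powr_mono norm_gchoose_le) (auto simp: M_def)
        finally show ?thesis .
      qed
      have "norm (suminf r) \<le> (\<Sum>n. real (Suc M) * B ^ (Suc M) * real (Suc n) powr (- (5/4)))"
        by (rule norm_suminf_le[OF r]) (intro summable_mult S)
      also have "\<dots> = real (Suc M) * B ^ (Suc M) * S"
        unfolding S_def by (rule suminf_mult[OF S])
      finally have E: "norm ((s - 1) * zeta s - 1 - Sig) \<le> real (Suc M) * S * B ^ (N + 2)"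
        using sums_unique[OF rs] by (simp add: M_def mult_ac)
      have "norm Sig \<le> (\<Sum>k\<in>{2..M}. C (k - 1) * real (Suc M) ^ (N + 2) * B ^ (N + 3))"
        unfolding Sig_def
      proof (rule sum_norm_le)
        fix k assume k: "k \<in> {2..M}"
        then have j: "k - 1 \<in> {1..N}" by (auto simp: M_def)
        have "norm (s + of_nat k - 1) \<le> norm s + real (k - 1)"
          using norm_triangle_ineq[of s "of_nat (k - 1)"] k by (simp add: of_nat_diff algebra_simps)
        also have "real (k - 1) \<le> real M * 1" using k by simp
        also have "\<dots> \<le> real M * B" using B by (intro mult_left_mono) auto
        finally have nk: "norm (s + of_nat k - 1) + 2 \<le> real (Suc M) * B"
          by (simp add: B_def algebra_simps)
        have "norm (((1 - s) gchoose k) * zeta (s + of_nat k - 1)) \<le>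
            B ^ k * (C (k - 1) * (norm (s + of_nat k - 1) + 2) ^ (N - (k - 1) + 2))"
          unfolding norm_mult
          using s k j B by (intro mult_mono norm_gchoose_le C) (auto simp: of_nat_diff M_def)
        also have "\<dots> \<le> B ^ k * (C (k - 1) * (real (Suc M) * B) ^ (N - (k - 1) + 2))"
          using B C(1)[OF j] nk by (intro mult_left_mono power_mono) auto
        also have "\<dots> = C (k - 1) * real (Suc M) ^ (N - (k - 1) + 2) * B ^ (N + 3)"
        proof -
          have "k + (N - (k - 1) + 2) = N + 3" using k by (auto simp: M_def)
          then have eq: "B ^ k * B ^ (N - (k - 1) + 2) = B ^ (N + 3)" by (metis power_add)
          have "B ^ k * (c * (d * B) ^ e) = c * d ^ e * (B ^ k * B ^ e)" for c d e
            by (simp add: power_mult_distrib mult_ac)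
          then show ?thesis by (simp only: eq)
        qed
        also have "\<dots> \<le> C (k - 1) * real (Suc M) ^ (N + 2) * B ^ (N + 3)"
          using B C(1)[OF j] k by (intro mult_right_mono mult_left_mono power_increasing) auto
        finally show "norm (((1 - s) gchoose k) * zeta (s + of_nat k - 1)) \<le>
            C (k - 1) * real (Suc M) ^ (N + 2) * B ^ (N + 3)" .
      qed
      also have "\<dots> = (\<Sum>k\<in>{2..M}. C (k - 1) * real (Suc M) ^ (N + 2)) * B ^ (N + 3)"
        by (simp add: sum_distrib_right)
      finally have Sig: "norm Sig \<le> (\<Sum>k\<in>{2..M}. C (k - 1) * real (Suc M) ^ (N + 2)) * B ^ (N + 3)" .
      have pw: "B ^ (N + 2) \<le> B ^ (N + 3)" "1 \<le> B ^ (N + 3)"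
        using B by (intro power_increasing one_le_power; simp)+
      have "norm ((s - 1) * zeta s) \<le> norm ((s - 1) * zeta s - 1 - Sig) + 1 + norm Sig"
        using norm_triangle_ineq[of "(s - 1) * zeta s - 1 - Sig" "1 + Sig"] norm_triangle_ineq[of 1 Sig]
        by simp
      also have "\<dots> \<le> real (Suc M) * S * B ^ (N + 3) + B ^ (N + 3)
          + (\<Sum>k\<in>{2..M}. C (k - 1) * real (Suc M) ^ (N + 2)) * B ^ (N + 3)"
        using S0 pw by (intro add_mono order_trans[OF E] Sig mult_left_mono) auto
      also have "\<dots> = K / 4 * B ^ (N + 3)"
        by (simp add: K_def algebra_simps)
      also have "\<dots> \<le> K * (norm (s - 1) * B ^ (N + 2))"
      proof -
        \<comment> \<open>From \<open>norm s \<le> norm (s - 1) + 1\<close> and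
          \<open>1 \<le> norm (s - 1)\<close> follows \<open>B \<le> 4 * norm (s - 1)\<close>; the
          bound on \<open>Im s\<close> keeps \<open>s\<close> away from the pole.\<close>
        have "norm (s - 1) \<ge> 1" using s abs_Im_le_cmod[of "s - 1"] by simp
        moreover have "norm s \<le> norm (s - 1) + 1" using norm_triangle_ineq[of "s - 1" 1] by simp
        ultimately have "B / 4 \<le> norm (s - 1)" by (simp add: B_def)
        then have "K * (B / 4 * B ^ (N + 2)) \<le> K * (norm (s - 1) * B ^ (N + 2))"
          using K0 B by (intro mult_left_mono mult_right_mono) auto
        then show ?thesis by (simp add: eval_nat_numeral mult_ac)
      qed
      finally have "norm (s - 1) * norm (zeta s) \<le> norm (s - 1) * (K * B ^ (N + 2))"
        by (simp add: norm_mult mult_ac)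
      moreover have "norm (s - 1) > 0" using s by auto
      ultimately show ?thesis by (simp add: B_def)
    qed
    with K0 show ?thesis by blast
  qed
qed

section \<open>The factor of the functional equation\<close>

lemma norm_sin_le_exp: "norm (sin z) \<le> exp \<bar>Im z\<bar>" for z :: complex
  using cmod_sin_le_exp[of 1 z] by simp

text \<open>On this line \<open>1 - z\<close> is the conjugate of \<open>z\<close>, so the
  reflection formula evaluates the modulus exactly: its square is
  \<open>pi / cosh (pi * t)\<close>.\<close>

lemma norm_Gamma_half:
  "norm (Gamma (Complex (1/2) t)) \<le> sqrt (2 * pi) * exp (- pi * \<bar>t\<bar> / 2)"
proof -
  define z where "z = Complex (1/2) t"
  have z: "1 - z = cnj z" by (simp add: z_def complex_eq_iff)
  have "norm (Gamma z * Gamma (1 - z)) = norm (Gamma z) ^ 2"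
    unfolding z cnj_Gamma[symmetric] by (simp add: norm_mult power2_eq_square)
  then have eq: "norm (Gamma z) ^ 2 = pi / norm (sin (of_real pi * z))"
    by (subst (asm) Gamma_reflection_complex) (simp add: norm_divide)
  have "sin (of_real pi * z) = cos (of_real pi * (\<i> * of_real t))"
  proof -
    have "of_real pi * z = of_real pi / 2 + of_real pi * (\<i> * of_real t)"
      by (simp add: z_def complex_eq_iff)
    then show ?thesis by (simp add: sin_add)
  qed
  also have "\<dots> = of_real (cosh (pi * t))"
    by (simp add: cos_exp_eq cosh_def exp_of_real[symmetric] scaleR_conv_of_real algebra_simps)
  finally have "norm (sin (of_real pi * z)) = cosh (pi * t)" by simp
  moreover have "exp (pi * \<bar>t\<bar>) / 2 \<le> cosh (pi * t)"
    by (cases "t \<ge> 0") (auto simp: cosh_def)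
  ultimately have "norm (Gamma z) ^ 2 \<le> pi / (exp (pi * \<bar>t\<bar>) / 2)"
    unfolding eq by (intro divide_left_mono) auto
  also have "\<dots> = (sqrt (2 * pi) * exp (- pi * \<bar>t\<bar> / 2)) ^ 2"
    by (simp add: power_mult_distrib exp_double[symmetric] exp_minus field_simps)
  finally show ?thesis
    unfolding z_def by (rule power2_le_imp_le) auto
qed

text \<open>Each Euler factor \<open>(x + k) / |x + k + it|\<close> increases with \<open>x\<close>.\<close>

lemma norm_Gamma_quotient_mono:
  assumes x: "0 < x" "x \<le> x'"
  shows "norm (Gamma (Complex x t)) / Gamma x \<le> norm (Gamma (Complex x' t)) / Gamma x'"
proof (rule LIMSEQ_le)
  have lim: "(\<lambda>n. norm (Gamma_series (Complex x t) n) / Gamma_series x n)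
      \<longlonglongrightarrow> norm (Gamma (Complex x t)) / Gamma x" if "x > 0" for x
  proof -
    have "Gamma x \<noteq> 0" using Gamma_real_pos[OF that] by linarith
    then show ?thesis by (intro tendsto_intros)
  qed
  show "(\<lambda>n. norm (Gamma_series (Complex x t) n) / Gamma_series x n)
      \<longlonglongrightarrow> norm (Gamma (Complex x t)) / Gamma x"
    and "(\<lambda>n. norm (Gamma_series (Complex x' t) n) / Gamma_series x' n)
      \<longlonglongrightarrow> norm (Gamma (Complex x' t)) / Gamma x'"
    using x by (auto intro: lim)
  \<comment> \<open>In Euler's approximations the numerators cancel, because
    \<open>n powr Complex x t\<close> has modulus \<open>n powr x\<close>; only the ratio of the
    Pochhammer products remains.\<close>
  have eq: "norm (Gamma_series (Complex x t) n) / Gamma_series x n =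
      (\<Prod>k\<le>n. (x + real k) / norm (Complex (x + real k) t))" if "x > 0" for x n
  proof -
    have "Complex x t + of_nat k = Complex (x + real k) t" for k by (simp add: complex_eq_iff)
    then show ?thesis
      unfolding Gamma_series_def pochhammer_prod
      by (simp add: norm_mult norm_divide prod_norm[symmetric] prod_dividef lessThan_Suc_atMost
            flip: lessThan_atLeast0)
  qed
  show "\<exists>N. \<forall>n\<ge>N. norm (Gamma_series (Complex x t) n) / Gamma_series x n
      \<le> norm (Gamma_series (Complex x' t) n) / Gamma_series x' n"
  proof (intro exI allI impI)
    fix n
    have "(x + real k) / norm (Complex (x + real k) t) \<le> (x' + real k) / norm (Complex (x' + real k) t)" for k
    proof -
      define a b where "a = x + real k" and "b = x' + real k"
      have ab: "0 < a" "a \<le> b" using x by (auto simp: a_def b_def)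
      \<comment> \<open>After squaring, the common term \<open>a\<^sup>2 * b\<^sup>2\<close> drops
        out and \<open>a\<^sup>2 * t\<^sup>2 \<le> b\<^sup>2 * t\<^sup>2\<close> is left.\<close>
      have "a * sqrt (b\<^sup>2 + t\<^sup>2) \<le> b * sqrt (a\<^sup>2 + t\<^sup>2)"
      proof (rule power2_le_imp_le)
        have "a\<^sup>2 * t\<^sup>2 \<le> b\<^sup>2 * t\<^sup>2" using ab by (intro mult_right_mono power_mono) auto
        then show "(a * sqrt (b\<^sup>2 + t\<^sup>2))\<^sup>2 \<le> (b * sqrt (a\<^sup>2 + t\<^sup>2))\<^sup>2"
          by (simp add: power_mult_distrib algebra_simps)
      qed (use ab in auto)
      moreover have "sqrt (a\<^sup>2 + t\<^sup>2) > 0" "sqrt (b\<^sup>2 + t\<^sup>2) > 0"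
        using ab by (auto intro!: add_pos_nonneg)
      ultimately show ?thesis
        unfolding a_def[symmetric] b_def[symmetric] by (simp add: complex_norm field_simps)
    qed
    then show "norm (Gamma_series (Complex x t) n) / Gamma_series x n
      \<le> norm (Gamma_series (Complex x' t) n) / Gamma_series x' n"
      using x by (subst (1 2) eq) (auto intro!: prod_mono)
  qed
qed

lemma pochhammer_norm_ge:
  assumes "t \<ge> 0"
  shows "t ^ n \<le> norm (pochhammer (Complex x t) n)"
proof -
  have "(\<Prod>k<n. t) \<le> (\<Prod>k<n. norm (Complex x t + of_nat k))"
    using assms abs_Im_le_cmod[of "Complex x t + of_nat k" for k] by (intro prod_mono) auto
  then show ?thesis by (simp add: pochhammer_prod prod_norm lessThan_atLeast0)
qed

lemma Complex_notin_nonpos_Ints: "t \<noteq> 0 \<Longrightarrow> Complex x t \<notin> \<int>\<^sub>\<le>\<^sub>0"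
  by (auto elim!: nonpos_Ints_cases simp: complex_eq_iff)

lemma Gamma_shift:
  assumes "t \<noteq> 0"
  shows "Gamma (Complex (x + real n) t) = pochhammer (Complex x t) n * Gamma (Complex x t)"
proof -
  have "Complex x t + of_nat n = Complex (x + real n) t" by (simp add: complex_eq_iff)
  with pochhammer_Gamma[OF Complex_notin_nonpos_Ints[OF assms], of x n]
  show ?thesis using Complex_notin_nonpos_Ints[OF assms, of x] by (simp add: Gamma_eq_zero_iff)
qed

lemma norm_Gamma_shift_le:
  assumes "t > 0"
  shows "t ^ n * norm (Gamma (Complex x t)) \<le> norm (Gamma (Complex (x + real n) t))"
  using assms pochhammer_norm_ge[of t n x] by (simp add: Gamma_shift norm_mult mult_right_mono)

text \<open>A substitute for Stirling's formula. Moving right by \<open>n\<close> leads to abscissas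
  between \<open>1/2\<close> and \<open>n + 1/2\<close>; there
  \<open>norm_Gamma_quotient_mono\<close> compares with the right edge, which is reached from the
  line \<open>1/2\<close> through \<open>n\<close> linear factors of size at most
  \<open>(n + 2) * t\<close>.\<close>

lemma norm_Gamma_strip:
  "\<exists>C\<ge>0. \<forall>x t. 1/2 - real n \<le> x \<and> x \<le> 1/2 \<and> 1 \<le> t \<longrightarrow>
     norm (Gamma (Complex x t)) \<le> C * t ^ n * exp (- pi * t / 2)"
proof -
  have "continuous_on {1/2..real n + 1/2} (Gamma :: real \<Rightarrow> real)"
    by (intro continuous_intros) (auto elim!: nonpos_Ints_cases)
  then have "bounded (Gamma ` {1/2..real n + 1/2})"
    by (intro compact_imp_bounded compact_continuous_image) auto
  then obtain b where "\<forall>y\<in>Gamma ` {1/2..real n + 1/2}. norm y \<le> b"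
    unfolding bounded_iff by blast
  then have b: "\<bar>Gamma x\<bar> \<le> b" if "x \<in> {1/2..real n + 1/2}" for x
    using that by (metis imageI real_norm_def)
  have b0: "b \<ge> 0" using order_trans[OF abs_ge_zero b[of "1/2"]] by simp
  define d where "d = Gamma (real n + 1/2)"
  have d: "d > 0" unfolding d_def by (intro Gamma_real_pos) auto
  define C where "C = b / d * ((real n + 2) ^ n * sqrt (2 * pi))"
  have "norm (Gamma (Complex x t)) \<le> C * t ^ n * exp (- pi * t / 2)"
    if x: "1/2 - real n \<le> x" "x \<le> 1/2" "1 \<le> t" for x t
  proof -
    have "norm (Gamma (Complex x t)) \<le> t ^ n * norm (Gamma (Complex x t))"
      using x mult_right_mono[of 1 "t ^ n" "norm (Gamma (Complex x t))"] by simp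
    also have "\<dots> \<le> norm (Gamma (Complex (x + real n) t))"
      using x by (intro norm_Gamma_shift_le) auto
    also have "\<dots> \<le> Gamma (x + real n) * (norm (Gamma (Complex (real n + 1/2) t)) / d)"
      using norm_Gamma_quotient_mono[of "x + real n" "real n + 1/2" t] x Gamma_real_pos[of "x + real n"]
      by (simp add: d_def field_simps)
    also have "\<dots> \<le> b * (norm (Gamma (Complex (real n + 1/2) t)) / d)"
      using b[of "x + real n"] x d by (intro mult_right_mono) auto
    also have "\<dots> = b / d * (norm (pochhammer (Complex (1/2) t) n) * norm (Gamma (Complex (1/2) t)))"
      using Gamma_shift[of t "1/2" n] x by (simp add: norm_mult add_ac)
    also have "\<dots> \<le> b / d * (((real n + 2) * t) ^ n * (sqrt (2 * pi) * exp (- pi * \<bar>t\<bar> / 2)))"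
    proof (intro mult_left_mono mult_mono norm_Gamma_half)
      have "norm (Complex (1/2) t + of_nat k) \<le> (real n + 2) * t" if "k < n" for k
      proof -
        have "norm (Complex (1/2) t + of_nat k) \<le> \<bar>1/2 + real k\<bar> + \<bar>t\<bar>"
          using cmod_le[of "Complex (1/2) t + of_nat k"] by simp
        also have "\<dots> \<le> (real n + 1) * 1 + t" using that x by auto
        also have "\<dots> \<le> (real n + 1) * t + t" using x by (intro add_mono mult_left_mono) auto
        finally show ?thesis by (simp add: algebra_simps)
      qed
      then have "(\<Prod>k<n. norm (Complex (1/2) t + of_nat k)) \<le> (\<Prod>k<n. (real n + 2) * t)"
        by (intro prod_mono) auto
      then show "norm (pochhammer (Complex (1/2) t) n) \<le> ((real n + 2) * t) ^ n"
        by (simp add: pochhammer_prod prod_norm lessThan_atLeast0)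
    qed (use b0 d x in auto)
    also have "\<dots> = C * t ^ n * exp (- pi * t / 2)"
      using x by (simp add: C_def power_mult_distrib)
    finally show ?thesis .
  qed
  moreover have "C \<ge> 0" unfolding C_def using b0 d by simp
  ultimately show ?thesis by blast
qed

text \<open>The growth of the sine is kept next to \<open>Gamma s\<close>, so that the exponential
  decay of the latter can cancel it exactly. The two powers are bounded by constants depending on
  \<open>n\<close> alone.\<close>

lemma norm_zeta_chi_le:
  assumes s: "- real n \<le> Re s" "0 \<le> Im s"
  shows "norm (zeta_chi (1 - s)) \<le> 2 ^ Suc n * pi ^ n * (exp (pi * Im s / 2) * norm (Gamma s))"
proof -
  have "norm (2 powr (1 - s)) = 2 powr (1 - Re s)"
    by (simp add: norm_powr_real_powr)
  also have "\<dots> \<le> 2 powr (real (Suc n))" using s by (intro powr_mono) auto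
  finally have 1: "norm (2 powr (1 - s)) \<le> 2 ^ Suc n" by (simp add: powr_realpow del: of_nat_Suc)
  have "norm (of_real pi powr (1 - s - 1)) = pi powr (- Re s)"
    by (simp add: norm_powr_real_powr)
  also have "\<dots> \<le> pi powr (real n)" using s pi_ge_two by (intro powr_mono) auto
  finally have 2: "norm (of_real pi powr (1 - s - 1)) \<le> pi ^ n" by (simp add: powr_realpow)
  have 3: "norm (sin (of_real pi * (1 - s) / 2)) \<le> exp (pi * Im s / 2)"
    using norm_sin_le_exp[of "of_real pi * (1 - s) / 2"] s by (simp add: abs_mult)
  show ?thesis
    using mult_right_mono[OF mult_mono[OF mult_mono[OF 1 2] 3] norm_ge_zero[of "Gamma s"]]
    by (simp add: zeta_chi_def norm_mult mult_ac)
qed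

text \<open>The source of the power saving: \<open>Gamma s\<close> equals Gamma on the line
  \<open>1/2\<close> divided by \<open>n\<close> linear factors, each at least \<open>Im s\<close>
  in modulus.\<close>

lemma norm_zeta_chi_left:
  "\<exists>C\<ge>0. \<forall>s. Re s = 1/2 - real n \<and> 1 \<le> Im s \<longrightarrow> norm (zeta_chi (1 - s)) \<le> C / Im s ^ n"
proof -
  define K :: real where "K = 2 ^ Suc n * pi ^ n"
  have K: "K \<ge> 0" by (simp add: K_def)
  have "norm (zeta_chi (1 - s)) \<le> K * sqrt (2 * pi) / Im s ^ n"
    if s: "Re s = 1/2 - real n" "1 \<le> Im s" for s
  proof -
    have cs: "s = Complex (1/2 - real n) (Im s)" using s by (simp add: complex_eq_iff)
    have "Im s ^ n * norm (Gamma s) \<le> sqrt (2 * pi) * exp (- pi * Im s / 2)"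
      using norm_Gamma_shift_le[of "Im s" n "1/2 - real n"] norm_Gamma_half[of "Im s"] s cs by simp
    then have "norm (Gamma s) \<le> sqrt (2 * pi) * exp (- pi * Im s / 2) / Im s ^ n"
      using s by (subst pos_le_divide_eq) (auto simp: mult_ac)
    moreover have "norm (zeta_chi (1 - s)) \<le> K * (exp (pi * Im s / 2) * norm (Gamma s))"
      using norm_zeta_chi_le[of n s] s unfolding K_def by simp
    ultimately have "norm (zeta_chi (1 - s)) \<le> K * (exp (pi * Im s / 2) * (sqrt (2 * pi) * exp (- pi * Im s / 2) / Im s ^ n))"
      using K by (elim order_trans) (intro mult_left_mono; simp)
    also have "\<dots> = K * sqrt (2 * pi) / Im s ^ n"
      by (simp add: exp_minus)
    finally show ?thesis .
  qed
  with K show ?thesis by (intro exI[of _ "K * sqrt (2 * pi)"]) auto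
qed

text \<open>A crude bound that grows with \<open>Im s\<close>; it serves only inside the rectangle,
  where any fixed power can be absorbed by integrations by parts.\<close>

lemma norm_zeta_chi_strip:
  "\<exists>C\<ge>0. \<forall>s. 1/2 - real n \<le> Re s \<and> Re s \<le> 1/2 \<and> 1 \<le> Im s \<longrightarrow>
     norm (zeta_chi (1 - s)) \<le> C * Im s ^ n"
proof -
  define K :: real where "K = 2 ^ Suc n * pi ^ n"
  have K: "K \<ge> 0" by (simp add: K_def)
  obtain C where C: "C \<ge> 0" "\<And>x t. 1/2 - real n \<le> x \<Longrightarrow> x \<le> 1/2 \<Longrightarrow> 1 \<le> t \<Longrightarrow>
     norm (Gamma (Complex x t)) \<le> C * t ^ n * exp (- pi * t / 2)"
    using norm_Gamma_strip[of n] by blast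
  have "norm (zeta_chi (1 - s)) \<le> K * C * Im s ^ n"
    if s: "1/2 - real n \<le> Re s" "Re s \<le> 1/2" "1 \<le> Im s" for s
  proof -
    have "norm (Gamma s) \<le> C * Im s ^ n * exp (- pi * Im s / 2)"
      using C(2)[OF s] by simp
    moreover have "norm (zeta_chi (1 - s)) \<le> K * (exp (pi * Im s / 2) * norm (Gamma s))"
      using norm_zeta_chi_le[of n s] s unfolding K_def by simp
    ultimately have "norm (zeta_chi (1 - s)) \<le> K * (exp (pi * Im s / 2) * (C * Im s ^ n * exp (- pi * Im s / 2)))"
      using K by (elim order_trans) (intro mult_left_mono; simp)
    also have "\<dots> = K * C * Im s ^ n"
      by (simp add: exp_minus)
    finally show ?thesis .
  qed
  with K C(1) show ?thesis by (intro exI[of _ "K * C"]) auto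
qed

lemma zeta_chi_holomorphic: "(\<lambda>s. zeta_chi (1 - s)) holomorphic_on {s. 0 < Im s}"
  unfolding zeta_chi_def
  by (intro holomorphic_intros) (auto elim!: nonpos_Ints_cases)

section \<open>Shifting a smoothly weighted contour\<close>

text \<open>On a convex open set a holomorphic function has a primitive, which is holomorphic again,
  so the choice can be iterated; subtracting a constant normalises each primitive at
  \<open>p\<close>.\<close>

lemma iterated_primitives:
  fixes G :: "complex \<Rightarrow> complex"
  assumes U: "open U" "convex U" and G: "G holomorphic_on U"
  shows "\<exists>H. H 0 = G \<and> (\<forall>j. H j holomorphic_on U) \<and>
    (\<forall>j. \<forall>z\<in>U. (H (Suc j) has_field_derivative H j z) (at z)) \<and> (\<forall>j. H (Suc j) p = 0)"
proof -
  define prim where "prim = (\<lambda>f. SOME g. (\<forall>z\<in>U. (g has_field_derivative f z) (at z)) \<and> g p = (0 :: complex))"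
  have prim: "(\<forall>z\<in>U. (prim f has_field_derivative f z) (at z)) \<and> prim f p = 0"
    if f: "f holomorphic_on U" for f
  proof -
    have "\<exists>g. \<forall>x\<in>U. (g has_field_derivative f x) (at x within U)"
    proof (rule holomorphic_convex_primitive'[OF U(2,1) f])
      fix g assume "\<And>x. x \<in> U \<Longrightarrow> (g has_field_derivative f x) (at x within U)"
      then show ?thesis by (intro exI[of _ g]) simp
    qed
    then obtain g where g: "\<forall>x\<in>U. (g has_field_derivative f x) (at x within U)" ..
    have "((\<lambda>z. g z - g p) has_field_derivative f x) (at x)" if "x \<in> U" for x
      using DERIV_diff[OF bspec[OF g that] DERIV_const[of "g p"]] at_within_open[OF that U(1)] by simp
    then have "\<exists>g. (\<forall>z\<in>U. (g has_field_derivative f z) (at z)) \<and> g p = 0"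
      by (intro exI[of _ "\<lambda>z. g z - g p"]) simp
    then show ?thesis unfolding prim_def by (rule someI_ex)
  qed
  define H where "H = (\<lambda>j. (prim ^^ j) G)"
  have hol: "H j holomorphic_on U" for j
  proof (induction j)
    case (Suc j)
    have "H (Suc j) = prim (H j)" by (simp add: H_def)
    with prim[OF Suc] have "\<forall>z\<in>U. (H (Suc j) has_field_derivative H j z) (at z)" by simp
    then show ?case using holomorphic_on_open[OF U(1)] by blast
  qed (use G in \<open>simp add: H_def\<close>)
  have "(H (Suc j) has_field_derivative H j z) (at z)" if "z \<in> U" for j z
    using prim[OF hol[of j]] that by (simp add: H_def)
  moreover have "H (Suc j) p = 0" for j
    using prim[OF hol[of j]] by (simp add: H_def)
  moreover have "H 0 = G" by (simp add: H_def)
  ultimately show ?thesis using hol by (intro exI[of _ H]) simp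
qed

text \<open>The mean value inequality along two segments: up the left side from the corner, where
  each primitive costs a factor \<open>X\<close> on top of \<open>m\<close>, then horizontally, at
  cost \<open>L\<close>. Every step adds one more contribution from the left side, whence the factor
  \<open>real j\<close>.\<close>

lemma iterated_primitives_bound:
  fixes H :: "nat \<Rightarrow> complex \<Rightarrow> complex"
  assumes deriv: "\<And>j z. z \<in> R \<Longrightarrow> (H (Suc j) has_field_derivative H j z) (at z)"
    and R: "R = {z. a \<le> Re z \<and> Re z \<le> b \<and> t0 \<le> Im z \<and> Im z \<le> t1}" "t0 \<le> t1" "a \<le> b"
    and base: "\<And>j. H (Suc j) (Complex a t0) = 0"
    and M: "\<And>z. z \<in> R \<Longrightarrow> norm (H 0 z) \<le> M"
    and m: "\<And>z. z \<in> R \<Longrightarrow> Re z = a \<Longrightarrow> norm (H 0 z) \<le> m"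
    and L: "1 \<le> L" "b - a \<le> L" and X: "1 \<le> X" "t1 - t0 \<le> X"
    and z: "z \<in> R"
  shows "norm (H j z) \<le> L ^ j * (M + real j * X ^ j * m)"
proof -
  have conv: "convex R"
  proof -
    have "R = {z. a \<le> Re z} \<inter> {z. Re z \<le> b} \<inter> {z. t0 \<le> Im z} \<inter> {z. Im z \<le> t1}"
      unfolding R(1) by auto
    then show ?thesis
      by (simp add: convex_Int convex_halfspace_Re_ge convex_halfspace_Re_le
            convex_halfspace_Im_ge convex_halfspace_Im_le)
  qed
  define E where "E = R \<inter> {z. Re z = a}"
  have "{z. Re z = a} = {z. a \<le> Re z} \<inter> {z. Re z \<le> a}" by auto
  then have convE: "convex E"
    unfolding E_def by (simp add: conv convex_Int convex_halfspace_Re_ge convex_halfspace_Re_le)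
  have corner: "Complex a t0 \<in> E" using R by (auto simp: E_def)
  have m0: "m \<ge> 0" using order_trans[OF norm_ge_zero m[of "Complex a t0"]] corner
    by (simp add: E_def)
  have M0: "M \<ge> 0" using order_trans[OF norm_ge_zero M[of "Complex a t0"]] corner
    by (simp add: E_def)
  have within: "(H (Suc j) has_field_derivative H j z) (at z within S)" if "z \<in> R" for j z S
    using deriv[OF that] by (rule has_field_derivative_at_within)
  have left: "norm (H j z) \<le> X ^ j * m" if "z \<in> E" for j z
    using that
  proof (induction j arbitrary: z)
    case (Suc j)
    have "norm (H (Suc j) z - H (Suc j) (Complex a t0)) \<le> X ^ j * m * norm (z - Complex a t0)"
      using Suc corner by (intro field_differentiable_bound[OF convE]) (auto simp: E_def intro: within)
    also have "\<dots> \<le> X ^ j * m * X"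
    proof (rule mult_left_mono)
      have "z - Complex a t0 = Complex 0 (Im z - t0)" using Suc.prems by (simp add: E_def complex_eq_iff)
      then show "norm (z - Complex a t0) \<le> X" using Suc.prems X R by (simp add: E_def complex_norm)
    qed (use X m0 in simp)
    finally show ?case using base by (simp add: mult_ac)
  qed (use m in \<open>simp add: E_def\<close>)
  show ?thesis
    using z
  proof (induction j arbitrary: z)
    case (Suc j)
    \<comment> \<open>The horizontal projection of \<open>z\<close> to the left side, where the
      bound \<open>left\<close> is available.\<close>
    define p where "p = Complex a (Im z)"
    have p: "p \<in> E" using Suc.prems R by (auto simp: p_def E_def)
    have Xj: "X ^ j \<le> X ^ Suc j" using X by (intro power_increasing) auto
    have nonneg: "0 \<le> L ^ j * (M + real j * X ^ j * m)"
      using L X m0 M0 by simp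
    have "norm (H (Suc j) z - H (Suc j) p) \<le> L ^ j * (M + real j * X ^ j * m) * norm (z - p)"
      using Suc p by (intro field_differentiable_bound[OF conv]) (auto simp: E_def intro: within)
    also have "\<dots> \<le> L ^ j * (M + real j * X ^ j * m) * L"
    proof (rule mult_left_mono)
      have "z - p = Complex (Re z - a) 0" by (simp add: p_def complex_eq_iff)
      then show "norm (z - p) \<le> L" using Suc.prems L R by (simp add: complex_norm)
    qed (rule nonneg)
    also have "\<dots> = L ^ Suc j * (M + real j * X ^ j * m)" by simp
    also have "\<dots> \<le> L ^ Suc j * (M + real j * X ^ Suc j * m)"
      using Xj L m0 by (intro mult_left_mono add_left_mono mult_right_mono) auto
    finally have 1: "norm (H (Suc j) z - H (Suc j) p) \<le> L ^ Suc j * (M + real j * X ^ Suc j * m)" .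
    have "norm (H (Suc j) p) \<le> 1 * (X ^ Suc j * m)" using left[OF p, of "Suc j"] by simp
    also have "\<dots> \<le> L ^ Suc j * (X ^ Suc j * m)"
      using L X m0 by (intro mult_right_mono one_le_power) auto
    finally have "norm (H (Suc j) z) \<le> L ^ Suc j * (M + real j * X ^ Suc j * m) + L ^ Suc j * (X ^ Suc j * m)"
      using 1 norm_triangle_ineq[of "H (Suc j) z - H (Suc j) p" "H (Suc j) p"] by simp
    also have "\<dots> = L ^ Suc j * (M + real (Suc j) * X ^ Suc j * m)"
      by (simp add: algebra_simps)
    finally show ?case .
  qed (use M in simp)
qed

text \<open>The boundary terms vanish with the weight and its derivatives. Each step produces only a
  unit factor, from differentiating along a vertical line and from the sign, so the norm stays
  unchanged.\<close>

lemma integral_repeated_by_parts: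
  fixes H :: "nat \<Rightarrow> complex \<Rightarrow> complex" and \<phi> :: "nat \<Rightarrow> real \<Rightarrow> real"
  assumes deriv: "\<And>j t. t \<in> {t0..t1} \<Longrightarrow> (H (Suc j) has_field_derivative H j (Complex b t)) (at (Complex b t))"
    and cont0: "continuous_on {t0..t1} (\<lambda>t. H 0 (Complex b t))"
    and \<phi>: "\<And>j t. (\<phi> j has_real_derivative \<phi> (Suc j) t) (at t)"
    and zero: "\<And>j. \<phi> j t0 = 0" "\<And>j. \<phi> j t1 = 0" and "t0 \<le> t1"
  shows "norm (integral {t0..t1} (\<lambda>t. H 0 (Complex b t) * of_real (\<phi> 0 t))) =
         norm (integral {t0..t1} (\<lambda>t. H j (Complex b t) * of_real (\<phi> j t)))"
    and "continuous_on {t0..t1} (\<lambda>t. H j (Complex b t) * of_real (\<phi> j t))"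
proof -
  have dC: "((\<lambda>t. Complex b t) has_vector_derivative \<i>) (at t)" for t
    by (auto simp: has_vector_derivative_complex_iff intro!: derivative_eq_intros)
  have dH: "((\<lambda>t. H (Suc j) (Complex b t)) has_vector_derivative \<i> * H j (Complex b t)) (at t)"
    if "t \<in> {t0..t1}" for j t
    using field_vector_diff_chain_at[OF dC deriv[OF that]] by (simp add: o_def)
  have d\<phi>: "((\<lambda>t. of_real (\<phi> j t) :: complex) has_vector_derivative of_real (\<phi> (Suc j) t)) (at t)" for j t
    using \<phi>[of j t] by (intro has_vector_derivative_of_real) (simp add: has_real_derivative_iff_has_vector_derivative)
  have cH: "continuous_on {t0..t1} (\<lambda>t. H j (Complex b t))" for j
  proof (cases j)
    case (Suc i)
    show ?thesis
      unfolding Suc using dH by (intro continuous_at_imp_continuous_on ballI has_vector_derivative_continuous)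
  qed (use cont0 in simp)
  have c\<phi>: "continuous_on {t0..t1} (\<lambda>t. of_real (\<phi> j t) :: complex)" for j
    using d\<phi> by (intro continuous_at_imp_continuous_on ballI has_vector_derivative_continuous)
  show "continuous_on {t0..t1} (\<lambda>t. H j (Complex b t) * of_real (\<phi> j t))" for j
    by (intro continuous_on_mult cH c\<phi>)
  show "norm (integral {t0..t1} (\<lambda>t. H 0 (Complex b t) * of_real (\<phi> 0 t))) =
         norm (integral {t0..t1} (\<lambda>t. H j (Complex b t) * of_real (\<phi> j t)))"
  proof (induction j)
    case (Suc j)
    define I where "I = integral {t0..t1} (\<lambda>t. H (Suc j) (Complex b t) * of_real (\<phi> (Suc j) t))"
    have "((\<lambda>t. H (Suc j) (Complex b t) * of_real (\<phi> (Suc j) t)) has_integral I) {t0..t1}"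
      unfolding I_def by (intro integrable_integral integrable_continuous_interval continuous_on_mult cH c\<phi>)
    then have "((\<lambda>t. \<i> * H j (Complex b t) * of_real (\<phi> j t)) has_integral - I) {t0..t1}"
      by (intro integration_by_parts[OF bounded_bilinear_mult \<open>t0 \<le> t1\<close> cH[of "Suc j"] c\<phi>[of j] dH d\<phi>])
         (auto simp: zero)
    then have "integral {t0..t1} (\<lambda>t. \<i> * H j (Complex b t) * of_real (\<phi> j t)) = - I"
      by (rule integral_unique)
    then have "\<i> * integral {t0..t1} (\<lambda>t. H j (Complex b t) * of_real (\<phi> j t)) = - I"
      by (simp add: mult.assoc)
    then have "norm (integral {t0..t1} (\<lambda>t. H j (Complex b t) * of_real (\<phi> j t))) = norm I"
      by (metis mult.left_neutral norm_ii norm_minus_cancel norm_mult)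
    then show ?case using Suc by (simp add: I_def)
  qed simp
qed

text \<open>
  A smooth weight has no analytic continuation, so the contour cannot be moved directly. Instead
  one integrates by parts against iterated primitives based at the lower left corner of the
  rectangle: each primitive costs a factor \<open>L\<close> along the horizontal sides, and only the bound
  \<open>m\<close> on the left side is multiplied by powers of the height.
\<close>

lemma smooth_contour_shift_bound:
  fixes G :: "complex \<Rightarrow> complex" and \<phi> :: "nat \<Rightarrow> real \<Rightarrow> real"
  assumes U: "open U" "convex U" "R \<subseteq> U" and G: "G holomorphic_on U"
    and R: "R = {z. a \<le> Re z \<and> Re z \<le> b \<and> t0 \<le> Im z \<and> Im z \<le> t1}" "t0 \<le> t1" "a \<le> b"
    and M: "\<And>z. z \<in> R \<Longrightarrow> norm (G z) \<le> M"
    and m: "\<And>z. z \<in> R \<Longrightarrow> Re z = a \<Longrightarrow> norm (G z) \<le> m"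
    and L: "1 \<le> L" "b - a \<le> L" and X: "1 \<le> X" "t1 - t0 \<le> X"
    and \<phi>: "\<And>j t. (\<phi> j has_real_derivative \<phi> (Suc j) t) (at t)"
    and zero: "\<And>j t. t \<le> t0 \<Longrightarrow> \<phi> j t = 0" "\<And>j t. t1 \<le> t \<Longrightarrow> \<phi> j t = 0"
    and D: "\<And>t. \<bar>\<phi> j t\<bar> \<le> D"
  shows "norm (LBINT t. G (Complex b t) * of_real (\<phi> 0 t)) \<le> L ^ j * (M + real j * X ^ j * m) * D * X"
proof -
  obtain H where H: "H 0 = G" "\<forall>j. H j holomorphic_on U"
    "\<forall>j. \<forall>z\<in>U. (H (Suc j) has_field_derivative H j z) (at z)" "\<forall>j. H (Suc j) (Complex a t0) = 0"
    using iterated_primitives[OF U(1,2) G, of "Complex a t0"] by (elim exE conjE)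
  have seg: "Complex b t \<in> R" if "t \<in> {t0..t1}" for t using that R by auto
  have cG: "continuous_on {t0..t1} (\<lambda>t. H 0 (Complex b t))"
  proof -
    have "continuous_on {t0..t1} (\<lambda>t. Complex b t)"
      by (intro continuous_intros)
    moreover have "continuous_on ((\<lambda>t. Complex b t) ` {t0..t1}) G"
      by (rule continuous_on_subset[OF holomorphic_on_imp_continuous_on[OF G]]) (use seg U(3) in blast)
    ultimately have "continuous_on {t0..t1} (G \<circ> (\<lambda>t. Complex b t))"
      by (rule continuous_on_compose)
    then show ?thesis by (simp add: H o_def)
  qed
  have dH: "(H (Suc j) has_field_derivative H j (Complex b t)) (at (Complex b t))" if "t \<in> {t0..t1}" for j t
    using seg[OF that] U H(3) by blast
  note parts = integral_repeated_by_parts[of t0 t1 H b \<phi>, OF dH cG \<phi> zero(1)[OF order_refl] zero(2)[OF order_refl] R(2)]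
  have HB: "norm (H j (Complex b t)) \<le> L ^ j * (M + real j * X ^ j * m)" if "t \<in> {t0..t1}" for t
  proof (rule iterated_primitives_bound[where H = H, OF _ R H(4)[rule_format] _ _ L X seg[OF that]])
    show "(H (Suc j) has_field_derivative H j z) (at z)" if "z \<in> R" for j z
      using that U(3) H(3) by blast
  qed (simp_all add: H(1) M m)
  have K0: "0 \<le> L ^ j * (M + real j * X ^ j * m)" using order_trans[OF norm_ge_zero HB[of t0]] R(2) by simp
  have D0: "D \<ge> 0" using D[of 0] by linarith
  \<comment> \<open>The weight vanishes outside the interval, and the integrand is continuous on it,
    so the Lebesgue integral over the line becomes a gauge integral to which integration by parts
    applies.\<close>
  have "(LBINT t. G (Complex b t) * of_real (\<phi> 0 t)) = (LBINT t:{t0..t1}. G (Complex b t) * of_real (\<phi> 0 t))"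
    unfolding set_lebesgue_integral_def
  proof (intro Bochner_Integration.integral_cong refl)
    show "G (Complex b t) * of_real (\<phi> 0 t) = indicator {t0..t1} t *\<^sub>R (G (Complex b t) * of_real (\<phi> 0 t))" for t
      using zero(1)[of t 0] zero(2)[of t 0] by (cases "t \<in> {t0..t1}") (auto simp: not_le)
  qed
  also have "\<dots> = integral {t0..t1} (\<lambda>t. G (Complex b t) * of_real (\<phi> 0 t))"
    using parts(2)[of 0] by (intro set_borel_integral_eq_integral(2) borel_integrable_atLeastAtMost') (simp add: H)
  finally have "norm (LBINT t. G (Complex b t) * of_real (\<phi> 0 t)) =
      norm (integral {t0..t1} (\<lambda>t. H j (Complex b t) * of_real (\<phi> j t)))"
    using parts(1)[of j] by (simp add: H)
  also have "\<dots> \<le> L ^ j * (M + real j * X ^ j * m) * D * (t1 - t0)"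
  proof (rule integral_bound[OF R(2) parts(2)])
    fix t assume t: "t \<in> {t0..t1}"
    show "norm (H j (Complex b t) * of_real (\<phi> j t)) \<le> L ^ j * (M + real j * X ^ j * m) * D"
      unfolding norm_mult using HB[OF t] D[of t] K0 by (intro mult_mono) auto
  qed
  also have "\<dots> \<le> L ^ j * (M + real j * X ^ j * m) * D * X"
    using X K0 D0 by (intro mult_left_mono) auto
  finally show ?thesis .
qed

section \<open>The twisted moments\<close>

lemma poly_weight_bounded:
  "\<exists>C\<ge>0. \<forall>y n. 1 < y \<and> 1 \<le> n \<and> real n \<le> y \<longrightarrow> \<bar>poly_weight P y n\<bar> \<le> C"
proof -
  have "bounded (poly P ` {0..1})"
    by (intro compact_imp_bounded compact_continuous_image continuous_intros compact_Icc)
  then obtain C where C: "\<forall>x\<in>poly P ` {0..1}. norm x \<le> C"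
    unfolding bounded_iff by blast
  have "\<bar>poly_weight P y n\<bar> \<le> C" if "1 < y" "1 \<le> n" "real n \<le> y" for y n
  proof -
    \<comment> \<open>All arguments of the polynomial lie in a fixed compact interval, so the bound
      is uniform in \<open>y\<close>.\<close>
    have "ln (y / real n) / ln y \<in> {0..1}"
      using that by (simp add: ln_div)
    then have "poly P (ln (y / real n) / ln y) \<in> poly P ` {0..1}" by (rule imageI)
    with C show ?thesis unfolding poly_weight_def real_norm_def by blast
  qed
  moreover have "C \<ge> 0" using order_trans[OF norm_ge_zero bspec[OF C imageI[of 0]]] by simp
  ultimately show ?thesis by blast
qed

text \<open>The trivial estimate: at most \<open>y\<close> terms, each at most
  \<open>C * y ^ n\<close>. The constant precedes the quantifier over \<open>n\<close>, so it serves
  for \<open>s\<close> and, with \<open>n = 0\<close>, for \<open>1 - s\<close>.\<close>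

lemma norm_dirichlet_poly_le:
  "\<exists>C\<ge>0. \<forall>y s n. 1 < y \<and> - real n \<le> Re s \<longrightarrow> norm (dirichlet_poly P y s) \<le> C * y ^ Suc n"
proof -
  obtain C where C: "C \<ge> 0" "\<And>y n. 1 < y \<Longrightarrow> 1 \<le> n \<Longrightarrow> real n \<le> y \<Longrightarrow> \<bar>poly_weight P y n\<bar> \<le> C"
    using poly_weight_bounded[of P] by blast
  have "norm (dirichlet_poly P y s) \<le> C * y ^ Suc n" if y: "1 < y" and s: "- real n \<le> Re s" for y s n
  proof -
    have set: "{m. 1 \<le> m \<and> real m \<le> y} = {1..nat \<lfloor>y\<rfloor>}"
      using y by (auto simp: le_nat_iff le_floor_iff)
    have "norm (dirichlet_poly P y s) \<le> (\<Sum>m | 1 \<le> m \<and> real m \<le> y. C * y ^ n)"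
      unfolding dirichlet_poly_def
    proof (rule sum_norm_le)
      fix m assume "m \<in> {m. 1 \<le> m \<and> real m \<le> y}"
      then have m: "1 \<le> m" "real m \<le> y" by auto
      have "norm (of_nat m powr (- s)) = real m powr (- Re s)"
        by (simp add: norm_powr_real_powr)
      also have "\<dots> \<le> real m powr real n" using s m by (intro powr_mono) auto
      also have "\<dots> = real m ^ n" using m by (simp add: powr_realpow)
      also have "\<dots> \<le> y ^ n" using m by (intro power_mono) auto
      finally show "norm (of_real (poly_weight P y m) * of_nat m powr (- s)) \<le> C * y ^ n"
        unfolding norm_mult norm_of_real using C(2)[OF y m] C(1) by (intro mult_mono) auto
    qed
    also have "\<dots> = real (nat \<lfloor>y\<rfloor>) * (C * y ^ n)" unfolding set by simp
    also have "\<dots> \<le> y * (C * y ^ n)" using y C(1) by (intro mult_right_mono) auto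
    finally show ?thesis by (simp add: mult_ac)
  qed
  with C(1) show ?thesis by blast
qed

lemma dirichlet_poly_holomorphic: "dirichlet_poly P y holomorphic_on S"
  unfolding dirichlet_poly_def[abs_def] by (intro holomorphic_intros) auto

lemma cnj_dirichlet_poly: "cnj (dirichlet_poly P y s) = dirichlet_poly P y (cnj s)"
  unfolding dirichlet_poly_def by (auto intro!: sum.cong simp: cnj_powr)

text \<open>The holomorphic form of the integrand: the modulus and the square of the Dirichlet
  polynomial are regrouped into \<open>k + \<nu>\<close> factors at \<open>s\<close> and
  \<open>k - \<nu>\<close> factors at \<open>1 - s\<close>. Lists of shifts allow one treatment of
  both moments, with lists of length 1 and 2.\<close>

definition twisted_product ::
  "nat \<Rightarrow> nat \<Rightarrow> real poly \<Rightarrow> real \<Rightarrow> complex list \<Rightarrow> complex list \<Rightarrow> complex \<Rightarrow> complex" where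
  "twisted_product k \<nu> P y as bs s =
     prod_list (map (\<lambda>a. zeta (s + a)) as) * prod_list (map (\<lambda>b. zeta (1 - s + b)) bs)
     * (dirichlet_poly P y s ^ (k + \<nu>) * dirichlet_poly P y (1 - s) ^ (k - \<nu>)) * zeta_chi (1 - s) ^ \<nu>"

lemma twisted_product_critical_line:
  assumes "\<nu> \<le> k"
  shows "twisted_product k \<nu> P y as bs (Complex (1/2) t) =
     prod_list (map (\<lambda>a. zeta (1/2 + a + \<i> * of_real t)) as) * prod_list (map (\<lambda>b. zeta (1/2 + b - \<i> * of_real t)) bs)
     * of_real (norm (dirichlet_poly P y (1/2 + \<i> * of_real t)) ^ (2 * k - 2 * \<nu>))
     * dirichlet_poly P y (1/2 + \<i> * of_real t) ^ (2 * \<nu>)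
     * zeta_chi (1/2 - \<i> * of_real t) ^ \<nu>"
proof -
  define A where "A = dirichlet_poly P y (Complex (1/2) t)"
  have s: "1/2 + \<i> * of_real t = Complex (1/2) t" "1/2 - \<i> * of_real t = 1 - Complex (1/2) t"
    "1/2 + a + \<i> * of_real t = Complex (1/2) t + a" "1/2 + a - \<i> * of_real t = 1 - Complex (1/2) t + a" for a
    by (simp_all add: complex_eq_iff)
  have "1 - Complex (1/2) t = cnj (Complex (1/2) t)" by (simp add: complex_eq_iff)
  then have B: "dirichlet_poly P y (1 - Complex (1/2) t) = cnj A"
    by (simp add: A_def cnj_dirichlet_poly)
  have "A ^ (k + \<nu>) * cnj A ^ (k - \<nu>) = (A * cnj A) ^ (k - \<nu>) * A ^ (2 * \<nu>)"
  proof -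
    \<comment> \<open>Here \<open>\<nu> \<le> k\<close> makes the subtraction of natural numbers
      exact.\<close>
    have "k + \<nu> = (k - \<nu>) + 2 * \<nu>" using assms by simp
    then have "A ^ (k + \<nu>) = A ^ (k - \<nu>) * A ^ (2 * \<nu>)" by (metis power_add)
    then show ?thesis by (simp add: power_mult_distrib mult_ac)
  qed
  also have "(A * cnj A) ^ (k - \<nu>) = of_real (norm A ^ (2 * k - 2 * \<nu>))"
    by (simp add: complex_norm_square[symmetric] power_mult[symmetric] diff_mult_distrib2)
  finally show ?thesis
    unfolding twisted_product_def s B A_def[symmetric] by (simp only: mult.assoc)
qed

text \<open>Shifts of modulus at most \<open>1/4\<close> cannot bring a point with
  \<open>Im s > 1\<close> to the pole of zeta, neither at \<open>s + a\<close> nor at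
  \<open>1 - s + a\<close>. The poles of Gamma are real.\<close>

lemma twisted_product_holomorphic:
  assumes "\<forall>a\<in>set as \<union> set bs. norm a \<le> 1/4"
  shows "twisted_product k \<nu> P y as bs holomorphic_on {s. 1 < Im s}"
proof -
  have shift: "\<bar>Im a\<bar> \<le> 1/4" if "a \<in> set as \<union> set bs" for a
    using assms that abs_Im_le_cmod[of a] by force
  have 1: "(\<lambda>s. zeta (s + a)) holomorphic_on {s. 1 < Im s}" if "a \<in> set as" for a
  proof -
    have "s + a \<noteq> 1" if "1 < Im s" for s
      using that shift[of a] \<open>a \<in> set as\<close> by (auto simp: complex_eq_iff)
    then have "(zeta \<circ> (\<lambda>s. s + a)) holomorphic_on {s. 1 < Im s}"
      by (intro holomorphic_on_compose_gen[OF _ zeta_holomorphic] holomorphic_intros) auto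
    then show ?thesis by (simp add: o_def)
  qed
  have 2: "(\<lambda>s. zeta (1 - s + a)) holomorphic_on {s. 1 < Im s}" if "a \<in> set bs" for a
  proof -
    have "1 - s + a \<noteq> 1" if "1 < Im s" for s
      using that shift[of a] \<open>a \<in> set bs\<close> by (auto simp: complex_eq_iff)
    then have "(zeta \<circ> (\<lambda>s. 1 - s + a)) holomorphic_on {s. 1 < Im s}"
      by (intro holomorphic_on_compose_gen[OF _ zeta_holomorphic] holomorphic_intros) auto
    then show ?thesis by (simp add: o_def)
  qed
  have list: "(\<lambda>s. prod_list (map (\<lambda>a. f a s) xs)) holomorphic_on S"
    if "\<And>a. a \<in> set xs \<Longrightarrow> (\<lambda>s. f a s) holomorphic_on S" for f :: "complex \<Rightarrow> complex \<Rightarrow> complex" and xs S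
    using that by (induction xs) (auto intro!: holomorphic_intros)
  have 3: "(\<lambda>s. dirichlet_poly P y (1 - s)) holomorphic_on {s. 1 < Im s}"
    using holomorphic_on_compose_gen[OF _ dirichlet_poly_holomorphic, of "\<lambda>s. 1 - s" "{s. 1 < Im s}" UNIV P y]
    by (simp add: o_def holomorphic_intros)
  have 4: "(\<lambda>s. zeta_chi (1 - s)) holomorphic_on {s. 1 < Im s}"
    by (rule holomorphic_on_subset[OF zeta_chi_holomorphic]) auto
  show ?thesis
    unfolding twisted_product_def[abs_def]
    by (intro holomorphic_intros list 1 2 3 4 dirichlet_poly_holomorphic)
qed

section \<open>Size of the integrand to the left of the critical line\<close>

lemma norm_prod_list_le:
  fixes f :: "'a \<Rightarrow> complex"
  assumes "\<And>x. x \<in> set xs \<Longrightarrow> norm (f x) \<le> K"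
  shows "norm (prod_list (map f xs)) \<le> K ^ length xs"
  using assms
proof (induction xs)
  case (Cons x xs)
  have "norm (f x) * norm (prod_list (map f xs)) \<le> K * K ^ length xs"
    using Cons order_trans[OF norm_ge_zero, of "f x" K] by (intro mult_mono) auto
  then show ?case by (simp add: norm_mult)
qed simp

text \<open>After a shift of size \<open>1/4\<close> the real parts are at least
  \<open>1/4 - n = 5/4 - (n + 1)\<close> and \<open>1/4 = 5/4 - 1\<close>, so
  \<open>zeta_polynomial_bound\<close> gives the exponents \<open>n + 3\<close> and
  \<open>3\<close>. The lower bound on \<open>T\<close> keeps the imaginary parts above 1 in modulus
  and \<open>norm (s + a) + 2\<close> below \<open>5 * T\<close>.\<close>

lemma zeta_shift_bounds:
  "\<exists>C\<ge>0. \<forall>T s a. real n + 16 \<le> T \<and> 1/2 - real n \<le> Re s \<and> Re s \<le> 1/2 \<and>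
     T / 8 \<le> Im s \<and> Im s \<le> 4 * T \<and> norm a \<le> 1/4 \<longrightarrow>
     norm (zeta (s + a)) \<le> C * T ^ (n + 3) \<and> norm (zeta (1 - s + a)) \<le> C * T ^ 3"
proof -
  obtain C1 where C1: "C1 \<ge> 0" "\<And>s. 5/4 - real (n + 1) \<le> Re s \<Longrightarrow> 1 \<le> \<bar>Im s\<bar> \<Longrightarrow>
      norm (zeta s) \<le> C1 * (norm s + 2) ^ (n + 1 + 2)"
    using zeta_polynomial_bound[of "n + 1"] by blast
  obtain C2 where C2: "C2 \<ge> 0" "\<And>s. 5/4 - real 1 \<le> Re s \<Longrightarrow> 1 \<le> \<bar>Im s\<bar> \<Longrightarrow>
      norm (zeta s) \<le> C2 * (norm s + 2) ^ (1 + 2)"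
    using zeta_polynomial_bound[of 1] by blast
  define C where "C = max (C1 * 5 ^ (n + 3)) (C2 * 5 ^ 3)"
  have "norm (zeta (s + a)) \<le> C * T ^ (n + 3) \<and> norm (zeta (1 - s + a)) \<le> C * T ^ 3"
    if T: "real n + 16 \<le> T" and s: "1/2 - real n \<le> Re s" "Re s \<le> 1/2" "T / 8 \<le> Im s" "Im s \<le> 4 * T"
      and a: "norm a \<le> 1/4" for T s a
  proof
    have a': "\<bar>Re a\<bar> \<le> 1/4" "\<bar>Im a\<bar> \<le> 1/4"
      using a abs_Re_le_cmod[of a] abs_Im_le_cmod[of a] by linarith+
    have n1: "norm (s + a) + 2 \<le> 5 * T"
      using cmod_le[of "s + a"] s a' T by simp
    have n2: "norm (1 - s + a) + 2 \<le> 5 * T"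
      using cmod_le[of "1 - s + a"] s a' T by simp
    have "norm (zeta (s + a)) \<le> C1 * (norm (s + a) + 2) ^ (n + 1 + 2)"
      using s a' T by (intro C1) auto
    also have "\<dots> \<le> C1 * (5 * T) ^ (n + 1 + 2)"
      using n1 C1 by (intro mult_left_mono power_mono) auto
    also have "\<dots> = C1 * 5 ^ (n + 3) * T ^ (n + 3)"
      unfolding power_mult_distrib by (simp add: numeral_3_eq_3)
    also have "\<dots> \<le> C * T ^ (n + 3)" using T by (intro mult_right_mono) (auto simp: C_def)
    finally show "norm (zeta (s + a)) \<le> C * T ^ (n + 3)" .
    have "norm (zeta (1 - s + a)) \<le> C2 * (norm (1 - s + a) + 2) ^ (1 + 2)"
      using s a' T by (intro C2) auto
    also have "\<dots> \<le> C2 * (5 * T) ^ (1 + 2)"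
      using n2 C2 by (intro mult_left_mono power_mono) auto
    also have "\<dots> = C2 * 5 ^ 3 * T ^ 3"
      unfolding power_mult_distrib by (simp add: numeral_3_eq_3)
    also have "\<dots> \<le> C * T ^ 3" using T by (intro mult_right_mono) (auto simp: C_def)
    finally show "norm (zeta (1 - s + a)) \<le> C * T ^ 3" .
  qed
  moreover have "C \<ge> 0" using C1 by (simp add: C_def le_max_iff_disj)
  ultimately show ?thesis by blast
qed

text \<open>The zeta factors contribute \<open>r * ((n + 3) + 3)\<close> to the exponent, the
  Dirichlet polynomials at most \<open>\<theta> * (2 * k * n + 2 * k)\<close>. The bound
  \<open>X\<close> for the chi factor stays free, so that the estimate serves both for the whole
  rectangle and for its left side.\<close>

lemma twisted_product_bound:
  assumes \<nu>: "\<nu> \<le> k" and \<theta>: "0 < \<theta>" "2 * real k * \<theta> \<le> \<rho>" and \<rho>: "\<rho> \<le> 1"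
  shows "\<exists>C\<ge>0. \<forall>T s as bs X. real n + 16 \<le> T \<and> 1/2 - real n \<le> Re s \<and> Re s \<le> 1/2 \<and>
     T / 8 \<le> Im s \<and> Im s \<le> 4 * T \<and> length as = r \<and> length bs = r \<and> (\<forall>a\<in>set as \<union> set bs. norm a \<le> 1/4) \<and>
     norm (zeta_chi (1 - s)) \<le> X \<longrightarrow>
     norm (twisted_product k \<nu> P (T powr \<theta>) as bs s) \<le> C * T powr (real r * (real n + 6) + \<rho> * real n + 1) * X ^ \<nu>"
proof -
  obtain C where C: "C \<ge> 0" "\<And>T s a. real n + 16 \<le> T \<Longrightarrow> 1/2 - real n \<le> Re s \<Longrightarrow> Re s \<le> 1/2 \<Longrightarrow>
     T / 8 \<le> Im s \<Longrightarrow> Im s \<le> 4 * T \<Longrightarrow> norm a \<le> 1/4 \<Longrightarrow>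
     norm (zeta (s + a)) \<le> C * T ^ (n + 3) \<and> norm (zeta (1 - s + a)) \<le> C * T ^ 3"
    using zeta_shift_bounds[of n] by blast
  obtain D where D: "D \<ge> 0" "\<And>y s n. 1 < y \<Longrightarrow> - real n \<le> Re s \<Longrightarrow> norm (dirichlet_poly P y s) \<le> D * y ^ Suc n"
    using norm_dirichlet_poly_le[of P] by blast
  define K where "K = C ^ r * C ^ r * D ^ (2 * k)"
  have "norm (twisted_product k \<nu> P (T powr \<theta>) as bs s) \<le> K * T powr (real r * (real n + 6) + \<rho> * real n + 1) * X ^ \<nu>"
    if T: "real n + 16 \<le> T" and s: "1/2 - real n \<le> Re s" "Re s \<le> 1/2" "T / 8 \<le> Im s" "Im s \<le> 4 * T"
      and len: "length as = r" "length bs = r" and small: "\<forall>a\<in>set as \<union> set bs. norm a \<le> 1/4"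
      and X: "norm (zeta_chi (1 - s)) \<le> X" for T s as bs X
  proof -
    have T1: "T > 1" using T by simp
    define y where "y = T powr \<theta>"
    have y: "y > 1" using T1 \<theta> by (simp add: y_def gr_one_powr)
    have 1: "norm (prod_list (map (\<lambda>a. zeta (s + a)) as)) \<le> (C * T ^ (n + 3)) ^ r"
      using C(2)[OF T s] small by (subst len(1)[symmetric], intro norm_prod_list_le) blast
    have 2: "norm (prod_list (map (\<lambda>b. zeta (1 - s + b)) bs)) \<le> (C * T ^ 3) ^ r"
      using C(2)[OF T s] small by (subst len(2)[symmetric], intro norm_prod_list_le) blast
    have 3: "norm (dirichlet_poly P y s ^ (k + \<nu>)) \<le> (D * y ^ Suc n) ^ (k + \<nu>)"
      unfolding norm_power using D(2)[OF y, of n s] s by (intro power_mono) auto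
    have 4: "norm (dirichlet_poly P y (1 - s) ^ (k - \<nu>)) \<le> (D * y) ^ (k - \<nu>)"
      unfolding norm_power using D(2)[OF y, of 0 "1 - s"] s by (intro power_mono) auto
    have "(D * y ^ Suc n) ^ (k + \<nu>) * (D * y) ^ (k - \<nu>) = D ^ (2 * k) * y ^ (Suc n * (k + \<nu>) + (k - \<nu>))"
    proof -
      have "2 * k = (k + \<nu>) + (k - \<nu>)" using \<nu> by simp
      then show ?thesis by (simp only: power_mult_distrib power_add power_mult) (simp add: mult_ac)
    qed
    also have "y ^ (Suc n * (k + \<nu>) + (k - \<nu>)) = T powr (\<theta> * real (Suc n * (k + \<nu>) + (k - \<nu>)))"
      unfolding y_def using T1 by (subst powr_realpow[symmetric]) (auto simp: powr_powr)
    also have "\<theta> * real (Suc n * (k + \<nu>) + (k - \<nu>)) \<le> \<rho> * real n + 1"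
    proof -
      have "Suc n * (k + \<nu>) + (k - \<nu>) = n * (k + \<nu>) + 2 * k" using \<nu> by simp
      also have "\<dots> \<le> n * (2 * k) + 2 * k" using \<nu> by simp
      finally have "real (Suc n * (k + \<nu>) + (k - \<nu>)) \<le> real (n * (2 * k) + 2 * k)" by (rule of_nat_mono)
      then have "\<theta> * real (Suc n * (k + \<nu>) + (k - \<nu>)) \<le> \<theta> * (real n * (2 * real k) + 2 * real k)"
        using \<theta> by (intro mult_left_mono) auto
      also have "\<dots> = (2 * real k * \<theta>) * real n + 2 * real k * \<theta>" by (simp add: algebra_simps)
      also have "\<dots> \<le> \<rho> * real n + 1" using \<theta> \<rho> by (intro add_mono mult_right_mono) auto
      finally show ?thesis .
    qed
    finally have 5: "(D * y ^ Suc n) ^ (k + \<nu>) * (D * y) ^ (k - \<nu>) \<le> D ^ (2 * k) * T powr (\<rho> * real n + 1)"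
      using T1 D(1) by (simp add: mult_left_mono)
    have 6: "(C * T ^ (n + 3)) ^ r * (C * T ^ 3) ^ r = C ^ r * C ^ r * T powr (real r * (real n + 6))"
    proof -
      have "(C * T ^ (n + 3)) ^ r * (C * T ^ 3) ^ r = C ^ r * C ^ r * T ^ (r * (n + 6))"
        by (simp add: power_mult_distrib power_mult[symmetric] power_add[symmetric] algebra_simps)
      then show ?thesis using T1 powr_realpow[of T "r * (n + 6)"] by simp
    qed
    have "norm (twisted_product k \<nu> P y as bs s) \<le>
        (C * T ^ (n + 3)) ^ r * (C * T ^ 3) ^ r * ((D * y ^ Suc n) ^ (k + \<nu>) * (D * y) ^ (k - \<nu>)) * X ^ \<nu>"
      unfolding twisted_product_def norm_mult[of _ "zeta_chi _ ^ _"] norm_mult[of _ "_ * _"]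
        norm_mult[of "prod_list _"] norm_mult[of "_ ^ _"] norm_power[of "zeta_chi _"]
      using C(1) D(1) T1 y by (intro mult_mono 1 2 3 4 power_mono X) auto
    also have "\<dots> \<le> C ^ r * C ^ r * T powr (real r * (real n + 6)) * (D ^ (2 * k) * T powr (\<rho> * real n + 1)) * X ^ \<nu>"
      unfolding 6 using 5 C(1) order_trans[OF norm_ge_zero X] by (intro mult_right_mono mult_left_mono) auto
    also have "\<dots> = K * T powr (real r * (real n + 6) + \<rho> * real n + 1) * X ^ \<nu>"
      by (simp add: K_def powr_add mult_ac)
    finally show ?thesis unfolding y_def .
  qed
  moreover have "K \<ge> 0" using C D by (simp add: K_def)
  ultimately show ?thesis by blast
qed

section \<open>Derivatives of the rescaled weight\<close>

lemma deriv_funpow_zero_on_open: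
  fixes f :: "real \<Rightarrow> real"
  assumes S: "open S" and f: "\<And>x. x \<in> S \<Longrightarrow> f x = 0" and x: "x \<in> S"
  shows "(deriv ^^ i) f x = 0"
  using x
proof (induction i arbitrary: x)
  case (Suc i)
  have "eventually (\<lambda>z. z \<in> S) (nhds x)" using S Suc.prems by (rule eventually_nhds_in_open)
  then have "eventually (\<lambda>z. (deriv ^^ i) f z = (\<lambda>_. 0) z) (nhds x)"
    by (rule eventually_mono) (use Suc.IH in simp)
  then have "deriv ((deriv ^^ i) f) x = deriv (\<lambda>_. 0) x"
    by (rule deriv_cong_ev) simp
  then show ?case by simp
qed (use f in simp)

text \<open>Smoothness of the weight is given in the variable \<open>x\<close>, its derivative
  bounds in \<open>t = x * T\<close>; the iterated chain rule connects the two.\<close>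

lemma deriv_funpow_rescale:
  fixes f :: "real \<Rightarrow> real"
  assumes f: "\<And>i x. (deriv ^^ i) f field_differentiable (at x)" and T: "T > 0"
  shows "(deriv ^^ i) (\<lambda>u. f (u / T)) = (\<lambda>t. (deriv ^^ i) f (t / T) / T ^ i)"
    and "((deriv ^^ i) (\<lambda>u. f (u / T)) has_real_derivative (deriv ^^ Suc i) (\<lambda>u. f (u / T)) t) (at t)"
proof -
  have D: "((\<lambda>t. (deriv ^^ i) f (t / T) / T ^ i) has_real_derivative (deriv ^^ Suc i) f (t / T) / T ^ Suc i) (at t)"
    for i t
  proof -
    have "((deriv ^^ i) f has_real_derivative (deriv ^^ Suc i) f (t / T)) (at (t / T))"
      using f[of i "t / T"] by (simp add: DERIV_deriv_iff_field_differentiable)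
    then have "((\<lambda>t. (deriv ^^ i) f (t / T)) has_real_derivative (deriv ^^ Suc i) f (t / T) * (1 / T)) (at t)"
      by (rule DERIV_chain2) (use T in \<open>auto intro!: derivative_eq_intros\<close>)
    from DERIV_cdivide[OF this, of "T ^ i"] show ?thesis by (simp add: mult_ac)
  qed
  show eq: "(deriv ^^ i) (\<lambda>u. f (u / T)) = (\<lambda>t. (deriv ^^ i) f (t / T) / T ^ i)" for i
  proof (induction i)
    case (Suc i)
    show ?case
    proof
      fix t
      have "(deriv ^^ Suc i) (\<lambda>u. f (u / T)) t = deriv (\<lambda>t. (deriv ^^ i) f (t / T) / T ^ i) t"
        by (simp add: Suc)
      also have "\<dots> = (deriv ^^ Suc i) f (t / T) / T ^ Suc i"
        by (rule DERIV_imp_deriv[OF D])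
      finally show "(deriv ^^ Suc i) (\<lambda>u. f (u / T)) t = (deriv ^^ Suc i) f (t / T) / T ^ Suc i" .
    qed
  qed simp
  show "((deriv ^^ i) (\<lambda>u. f (u / T)) has_real_derivative (deriv ^^ Suc i) (\<lambda>u. f (u / T)) t) (at t)"
    unfolding eq by (rule D)
qed

text \<open>Only a power of \<open>ln T\<close> survives in the final estimate. Bounding
  \<open>ln T\<close> by a multiple of \<open>T powr (1 / (2 * j))\<close> turns its
  \<open>j\<close>-th power into the square root of \<open>T\<close>.\<close>

lemma ln_power_le_sqrt:
  fixes T :: real
  assumes "T \<ge> 1" "j > 0"
  shows "ln T ^ j \<le> (2 * real j) ^ j * T powr (1/2)"
proof -
  have "ln T \<le> T powr (1 / (2 * real j)) / (1 / (2 * real j))"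
    using assms by (intro ln_powr_bound) auto
  then have "ln T ^ j \<le> (2 * real j * T powr (1 / (2 * real j))) ^ j"
    using assms by (intro power_mono) (auto simp: mult.commute)
  also have "(T powr (1 / (2 * real j))) ^ j = T powr (1/2)"
    using assms by (subst powr_realpow[symmetric]) (auto simp: powr_powr)
  then have "(2 * real j * T powr (1 / (2 * real j))) ^ j = (2 * real j) ^ j * T powr (1/2)"
    by (simp add: power_mult_distrib)
  finally show ?thesis .
qed

text \<open>Two parameters are fixed in turn: first the depth \<open>n\<close> of the left side, so
  that the integrand is \<open>O(1 / T)\<close> there, then the number \<open>j\<close> of
  integrations by parts, exceeding the exponent \<open>J\<close> of the crude bound in the
  rectangle.\<close>

lemma twisted_moment_bound:
  assumes adm: "admissible_weight \<Phi>"
    and \<nu>: "r < \<nu>" "\<nu> \<le> k" and \<theta>: "0 < \<theta>" "\<theta> < 1 / (2 * real k)"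
  shows "\<exists>K. \<forall>\<^sub>F T in at_top. \<forall>as bs. length as = r \<and> length bs = r \<and>
      (\<forall>a\<in>set as \<union> set bs. norm a \<le> 1/4) \<longrightarrow>
      norm (LBINT t. twisted_product k \<nu> P (T powr \<theta>) as bs (Complex (1/2) t) * of_real (\<Phi> T (t / T)))
        \<le> K * T powr (1/2)"
proof -
  define \<rho> where "\<rho> = 2 * real k * \<theta>"
  have \<rho>: "0 < \<rho>" "\<rho> < 1" using \<nu> \<theta> by (auto simp: \<rho>_def field_simps)
  \<comment> \<open>Chosen so that \<open>r * (n + 6) + \<rho> * n + 1 - n * \<nu> \<le> -1\<close>,
    which for \<open>\<nu> \<ge> r + 1\<close> follows from
    \<open>6 * r + 2 \<le> n * (1 - \<rho>)\<close>. The successor ensures \<open>n \<ge> 1\<close>,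
    since the width \<open>n\<close> also plays the part of \<open>L\<close>.\<close>
  define n where "n = Suc (nat \<lceil>(6 * real r + 2) / (1 - \<rho>)\<rceil>)"
  have n1: "n \<ge> 1" by (simp add: n_def)
  have "(6 * real r + 2) / (1 - \<rho>) \<le> real n" unfolding n_def by linarith
  then have n2: "6 * real r + 2 \<le> real n * (1 - \<rho>)" using \<rho> by (simp add: field_simps)
  \<comment> \<open>The exponent from \<open>twisted_product_bound\<close> with
    \<open>\<rho>\<close> rounded up to 1, plus \<open>n * \<nu>\<close> from the crude bound for
    the chi factor.\<close>
  define J where "J = r * (n + 6) + n + 1 + n * \<nu>"
  define j where "j = Suc J"
  have \<rho>': "2 * real k * \<theta> \<le> \<rho>" "\<rho> \<le> 1" using \<rho> by (auto simp: \<rho>_def)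
  obtain C where C: "C \<ge> 0" "\<forall>T s as bs X. real n + 16 \<le> T \<and> 1/2 - real n \<le> Re s \<and> Re s \<le> 1/2 \<and>
     T / 8 \<le> Im s \<and> Im s \<le> 4 * T \<and> length as = r \<and> length bs = r \<and> (\<forall>a\<in>set as \<union> set bs. norm a \<le> 1/4) \<and>
     norm (zeta_chi (1 - s)) \<le> X \<longrightarrow>
     norm (twisted_product k \<nu> P (T powr \<theta>) as bs s) \<le> C * T powr (real r * (real n + 6) + \<rho> * real n + 1) * X ^ \<nu>"
    using twisted_product_bound[OF \<nu>(2) \<theta>(1) \<rho>', of n r P] by (elim exE conjE)
  obtain A where A: "A \<ge> 0" "\<And>s. Re s = 1/2 - real n \<Longrightarrow> 1 \<le> Im s \<Longrightarrow> norm (zeta_chi (1 - s)) \<le> A / Im s ^ n"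
    using norm_zeta_chi_left[of n] by blast
  obtain B where B: "B \<ge> 0" "\<And>s. 1/2 - real n \<le> Re s \<Longrightarrow> Re s \<le> 1/2 \<Longrightarrow> 1 \<le> Im s \<Longrightarrow>
     norm (zeta_chi (1 - s)) \<le> B * Im s ^ n"
    using norm_zeta_chi_strip[of n] by blast
  obtain D where D: "\<forall>\<^sub>F T in at_top. \<forall>t. \<bar>(deriv ^^ j) (\<lambda>u. \<Phi> T (u / T)) t\<bar> \<le> D * (T / ln T) powr (- real j)"
    using adm unfolding admissible_weight_def by (elim conjE) (erule allE[of _ j], erule exE)
  have supp: "\<forall>\<^sub>F T in at_top. closure {x. \<Phi> T x \<noteq> 0} \<subseteq> {1/4..2}"
    and smooth: "\<forall>\<^sub>F T in at_top. \<forall>i x. (deriv ^^ i) (\<Phi> T) field_differentiable (at x)"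
    using adm[unfolded admissible_weight_def, THEN conjunct2]
    by (rule conjunct1, rule conjunct2[THEN conjunct1])
  define KM where "KM = C * (B * 4 ^ n) ^ \<nu>"
  define Km where "Km = C * (A * 8 ^ n) ^ \<nu>"
  \<comment> \<open>\<open>max D 0\<close> provides a nonnegative constant without deciding the sign
    of \<open>D\<close>.\<close>
  define Q where "Q = real n ^ j * (KM + real j * 4 ^ j * Km) * max D 0 * 4"
  have Q0: "Q \<ge> 0" using C(1) A(1) B(1) by (simp add: Q_def KM_def Km_def)
  have "\<forall>\<^sub>F T in at_top. \<forall>as bs. length as = r \<and> length bs = r \<and>
      (\<forall>a\<in>set as \<union> set bs. norm a \<le> 1/4) \<longrightarrow>
      norm (LBINT t. twisted_product k \<nu> P (T powr \<theta>) as bs (Complex (1/2) t) * of_real (\<Phi> T (t / T)))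
        \<le> Q * (2 * real j) ^ j * T powr (1/2)"
    using D supp smooth eventually_ge_at_top[of "real n + 16"]
  proof eventually_elim
    case (elim T)
    note T = elim(4)
    have T1: "T \<ge> 16" using T by simp
    have lnT: "ln T > 0" using T1 by simp
    define \<phi> where "\<phi> = (\<lambda>i. (deriv ^^ i) (\<lambda>u. \<Phi> T (u / T)))"
    have \<Phi>0: "\<Phi> T x = 0" if "x \<notin> {1/4..2}" for x
      using elim(2) that closure_subset[of "{x. \<Phi> T x \<noteq> 0}"] by blast
    have eq: "\<phi> i t = (deriv ^^ i) (\<Phi> T) (t / T) / T ^ i" for i t
      using deriv_funpow_rescale(1)[of "\<Phi> T" T i] elim(3) T1 by (simp add: \<phi>_def)
    \<comment> \<open>The range from \<open>T / 8\<close> to \<open>4 * T\<close> is strictly wider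
      than the support, so the weight is zero near each such \<open>t\<close> and all derivatives
      vanish there, endpoints included.\<close>
    have zero: "\<phi> i t = 0" if "t \<le> T / 8 \<or> 4 * T \<le> t" for i t
    proof -
      have "t / T < 1/4 \<or> 2 < t / T" using that T1 by (auto simp: field_simps)
      then have "(deriv ^^ i) (\<Phi> T) (t / T) = 0"
        using deriv_funpow_zero_on_open[of "{..<1/4}" "\<Phi> T" "t / T" i]
          deriv_funpow_zero_on_open[of "{2<..}" "\<Phi> T" "t / T" i] \<Phi>0
        by (elim disjE) simp_all
      then show ?thesis by (simp add: eq)
    qed
    have d\<phi>: "(\<phi> i has_real_derivative \<phi> (Suc i) t) (at t)" for i t
      unfolding \<phi>_def by (rule deriv_funpow_rescale(2)) (use elim(3) T1 in auto)
    define R where "R = {z. 1/2 - real n \<le> Re z \<and> Re z \<le> 1/2 \<and> T / 8 \<le> Im z \<and> Im z \<le> 4 * T}"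
    define E where "E = max D 0 * (T / ln T) powr (- real j)"
    have E: "\<bar>\<phi> j t\<bar> \<le> E" for t
    proof -
      have "\<bar>\<phi> j t\<bar> \<le> D * (T / ln T) powr (- real j)" using elim(1) by (simp add: \<phi>_def)
      also have "\<dots> \<le> E" unfolding E_def by (intro mult_right_mono) auto
      finally show ?thesis .
    qed
    show ?case
    proof (intro allI impI)
      fix as bs :: "complex list"
      assume *: "length as = r \<and> length bs = r \<and> (\<forall>a\<in>set as \<union> set bs. norm a \<le> 1/4)"
      define G where "G = twisted_product k \<nu> P (T powr \<theta>) as bs"
      have G: "norm (G s) \<le> C * T powr (real r * (real n + 6) + \<rho> * real n + 1) * X ^ \<nu>"
        if "s \<in> R" "norm (zeta_chi (1 - s)) \<le> X" for s X
        unfolding G_def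
        by (rule C(2)[rule_format], intro conjI) (use that * T in \<open>simp_all add: R_def\<close>)
      have M: "norm (G s) \<le> KM * T ^ J" if s: "s \<in> R" for s
      proof -
        have "norm (zeta_chi (1 - s)) \<le> B * Im s ^ n" using s T1 by (intro B(2)) (auto simp: R_def)
        also have "\<dots> \<le> B * (4 * T) ^ n"
          using s T1 B(1) by (intro mult_left_mono power_mono) (auto simp: R_def)
        finally have "norm (G s) \<le> C * T powr (real r * (real n + 6) + \<rho> * real n + 1) * (B * (4 * T) ^ n) ^ \<nu>"
          by (rule G[OF s])
        also have "\<dots> \<le> C * T powr real (r * (n + 6) + n + 1) * (B * (4 * T) ^ n) ^ \<nu>"
          using \<rho> T1 C(1) B(1) mult_right_mono[of \<rho> 1 "real n"]
          by (intro mult_right_mono mult_left_mono powr_mono) auto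
        also have "\<dots> = KM * T ^ J"
          using T1 by (subst powr_realpow) (auto simp: KM_def J_def power_mult_distrib power_add power_mult)
        finally show ?thesis .
      qed
      have m: "norm (G s) \<le> Km / T" if s: "s \<in> R" "Re s = 1/2 - real n" for s
      proof -
        have "norm (zeta_chi (1 - s)) \<le> A / Im s ^ n" using s T1 by (intro A(2)) (auto simp: R_def)
        also have "\<dots> \<le> A / (T / 8) ^ n"
        proof (intro divide_left_mono power_mono)
          have "0 < Im s" using s T1 by (simp add: R_def)
          then show "0 < Im s ^ n * (T / 8) ^ n" using T1 by simp
        qed (use s T1 A(1) in \<open>simp_all add: R_def\<close>)
        also have "\<dots> = A * 8 ^ n * T powr (- real n)"
          using T1 by (simp add: powr_minus_divide powr_realpow power_divide)
        finally have "norm (G s) \<le> C * T powr (real r * (real n + 6) + \<rho> * real n + 1) * (A * 8 ^ n * T powr (- real n)) ^ \<nu>"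
          by (rule G[OF s(1)])
        also have "\<dots> = Km * (T powr (real r * (real n + 6) + \<rho> * real n + 1) * (T powr (- real n)) ^ \<nu>)"
          unfolding Km_def power_mult_distrib by (simp only: mult_ac)
        also have "(T powr (- real n)) ^ \<nu> = T powr (- (real n * real \<nu>))"
          using T1 by (subst powr_realpow[symmetric]) (auto simp: powr_powr)
        also have "T powr (real r * (real n + 6) + \<rho> * real n + 1) * \<dots> =
            T powr (real r * (real n + 6) + \<rho> * real n + 1 - real n * real \<nu>)"
          by (simp only: diff_conv_add_uminus powr_add)
        also have "Km * \<dots> \<le> Km * T powr (-1)"
        proof (intro mult_left_mono powr_mono)
          \<comment> \<open>The decisive use of \<open>r < \<nu>\<close>: the chi factors outweigh
            the zeta factors by at least \<open>n\<close>, and \<open>\<rho> < 1\<close> leaves a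
            positive share of that.\<close>
          have "real n * (real r + 1) \<le> real n * real \<nu>" using \<nu> by (intro mult_left_mono) auto
          then show "real r * (real n + 6) + \<rho> * real n + 1 - real n * real \<nu> \<le> -1"
            using n2 by (simp add: algebra_simps)
        qed (use T1 C(1) A(1) in \<open>simp_all add: Km_def\<close>)
        finally show ?thesis using T1 by (simp add: powr_minus_divide)
      qed
      have "norm (LBINT t. G (Complex (1/2) t) * of_real (\<phi> 0 t)) \<le>
          real n ^ j * (KM * T ^ J + real j * (4 * T) ^ j * (Km / T)) * E * (4 * T)"
      proof (rule smooth_contour_shift_bound[OF _ _ _ _ R_def _ _ M m])
        show "convex {s. 1 < Im s}" "open {s. 1 < Im s}"
          by (auto simp: convex_halfspace_Im_gt open_halfspace_Im_gt)
        show "R \<subseteq> {s. 1 < Im s}" using T1 by (auto simp: R_def)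
        show "G holomorphic_on {s. 1 < Im s}"
          unfolding G_def by (rule twisted_product_holomorphic) (use * in blast)
        show "\<phi> i t = 0" if "t \<le> T / 8" for i t using zero[of t i] that by blast
        show "\<phi> i t = 0" if "4 * T \<le> t" for i t using zero[of t i] that by blast
        show "(\<phi> i has_real_derivative \<phi> (Suc i) t) (at t)" for i t by (rule d\<phi>)
        show "\<bar>\<phi> j t\<bar> \<le> E" for t by (rule E)
      qed (use T1 n1 in simp_all)
      \<comment> \<open>With \<open>j = J + 1\<close> the contribution of the left side,
        \<open>T ^ j / T\<close>, has the same order \<open>T ^ J\<close> as the crude
        bound.\<close>
      also have "\<dots> = real n ^ j * (KM + real j * 4 ^ j * Km) * T ^ J * E * (4 * T)"
        using T1 by (simp add: j_def power_mult_distrib field_simps)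
      also have "\<dots> = Q * ln T ^ j"
      proof -
        have "(T / ln T) powr (- real j) = ln T ^ j / T ^ j"
          using T1 lnT by (simp add: powr_minus powr_realpow power_divide)
        then have E_eq: "E = max D 0 * (ln T ^ j / T ^ j)" by (simp add: E_def)
        \<comment> \<open>The extra \<open>T\<close> is the length of the interval; it is exactly
          compensated by \<open>j - J = 1\<close>.\<close>
        have "T ^ J * (ln T ^ j / T ^ j) * T = ln T ^ j" using T1 by (simp add: j_def)
        then have "Q * (T ^ J * (ln T ^ j / T ^ j) * T) = Q * ln T ^ j" by simp
        then show ?thesis unfolding E_eq Q_def by (simp only: mult_ac)
      qed
      also have "\<dots> \<le> Q * ((2 * real j) ^ j * T powr (1/2))"
        using T1 Q0 by (intro mult_left_mono ln_power_le_sqrt) (auto simp: j_def)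
      finally show "norm (LBINT t. twisted_product k \<nu> P (T powr \<theta>) as bs (Complex (1/2) t) * of_real (\<Phi> T (t / T)))
        \<le> Q * (2 * real j) ^ j * T powr (1/2)"
        by (simp add: G_def \<phi>_def mult.assoc)
    qed
  qed
  then show ?thesis by blast
qed

section \<open>Shifts of order \<open>1 / ln T\<close> and the two moments\<close>

lemma eventually_shift_small:
  "\<forall>\<^sub>F T in at_top. c / ln T \<le> (1/4 :: real)"
proof -
  have "((\<lambda>T. c / ln T) \<longlongrightarrow> 0) at_top"
    by (rule tendsto_divide_0[OF tendsto_const filterlim_at_top_imp_at_infinity[OF ln_at_top]])
  then have "\<forall>\<^sub>F T in at_top. c / ln T < 1/4" by (rule order_tendstoD) simp
  then show ?thesis by (rule eventually_mono) simp
qed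

lemmas first_twisted_moment_bound = twisted_moment_bound[where r = 1]
lemmas second_twisted_moment_bound = twisted_moment_bound[where r = 2]

theorem theorem12:
  fixes k :: nat and P :: "real poly" and \<Phi> :: "real \<Rightarrow> real \<Rightarrow> real"
  assumes "k \<ge> 1" and "admissible_weight \<Phi>"
  shows "(\<forall>\<theta>::real. 0 < \<theta> \<and> \<theta> < 1 / (2 * real k) \<longrightarrow>
            (\<forall>\<nu>\<in>{2..k}. \<exists>\<epsilon>>0. \<forall>c>0. \<exists>K. \<forall>\<^sub>F T in at_top. \<forall>\<alpha>1 \<alpha>2.
               norm \<alpha>1 \<le> c / ln T \<and> norm \<alpha>2 \<le> c / ln T \<longrightarrow>
               norm (moment_I k \<nu> P (T powr \<theta>) (\<Phi> T) T \<alpha>1 \<alpha>2) \<le> K * T powr (1 - \<epsilon>)))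
       \<and> (\<forall>\<theta>::real. 0 < \<theta> \<and> \<theta> < 1 / (4 * real k) \<longrightarrow>
            (\<forall>\<nu>\<in>{3..k}. \<exists>\<epsilon>>0. \<forall>c>0. \<exists>K. \<forall>\<^sub>F T in at_top. \<forall>\<alpha>1 \<alpha>2 \<alpha>3 \<alpha>4.
               norm \<alpha>1 \<le> c / ln T \<and> norm \<alpha>2 \<le> c / ln T \<and>
               norm \<alpha>3 \<le> c / ln T \<and> norm \<alpha>4 \<le> c / ln T \<longrightarrow>
               norm (moment_J k \<nu> P (T powr \<theta>) (\<Phi> T) T \<alpha>1 \<alpha>2 \<alpha>3 \<alpha>4) \<le> K * T powr (1 - \<epsilon>)))"
proof (rule conjI; intro allI impI ballI)
  fix \<theta> :: real and \<nu>
  assume \<theta>: "0 < \<theta> \<and> \<theta> < 1 / (2 * real k)" and \<nu>: "\<nu> \<in> {2..k}"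
  then obtain K where K: "\<forall>\<^sub>F T in at_top. \<forall>as bs. length as = 1 \<and> length bs = 1 \<and>
      (\<forall>a\<in>set as \<union> set bs. norm a \<le> 1/4) \<longrightarrow>
      norm (LBINT t. twisted_product k \<nu> P (T powr \<theta>) as bs (Complex (1/2) t) * of_real (\<Phi> T (t / T)))
        \<le> K * T powr (1/2)"
    using first_twisted_moment_bound[OF assms(2), of \<nu> k \<theta> P] by force
  \<comment> \<open>The constant \<open>c\<close> affects only how large \<open>T\<close> must be
    for the shifts to be at most \<open>1/4\<close>; \<open>K\<close> and the saving
    \<open>1/2\<close> are independent of it.\<close>
  have "\<forall>\<^sub>F T in at_top. \<forall>\<alpha>1 \<alpha>2. norm \<alpha>1 \<le> c / ln T \<and> norm \<alpha>2 \<le> c / ln T \<longrightarrow>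
      norm (moment_I k \<nu> P (T powr \<theta>) (\<Phi> T) T \<alpha>1 \<alpha>2) \<le> K * T powr (1 - 1/2)" for c
    using K eventually_shift_small[of c]
  proof eventually_elim
    case (elim T)
    show ?case
    proof (intro allI impI)
      fix \<alpha>1 \<alpha>2 :: complex assume "norm \<alpha>1 \<le> c / ln T \<and> norm \<alpha>2 \<le> c / ln T"
      then have small: "norm \<alpha>1 \<le> 1/4" "norm \<alpha>2 \<le> 1/4" using elim(2) by linarith+
      have "moment_I k \<nu> P (T powr \<theta>) (\<Phi> T) T \<alpha>1 \<alpha>2 =
          (LBINT t. twisted_product k \<nu> P (T powr \<theta>) [\<alpha>1] [\<alpha>2] (Complex (1/2) t) * of_real (\<Phi> T (t / T)))"
        using \<nu> by (simp add: moment_I_def twisted_product_critical_line)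
      with elim(1)[rule_format, of "[\<alpha>1]" "[\<alpha>2]"] small
      show "norm (moment_I k \<nu> P (T powr \<theta>) (\<Phi> T) T \<alpha>1 \<alpha>2) \<le> K * T powr (1 - 1/2)" by simp
    qed
  qed
  then show "\<exists>\<epsilon>>0. \<forall>c>0. \<exists>K. \<forall>\<^sub>F T in at_top. \<forall>\<alpha>1 \<alpha>2.
      norm \<alpha>1 \<le> c / ln T \<and> norm \<alpha>2 \<le> c / ln T \<longrightarrow>
      norm (moment_I k \<nu> P (T powr \<theta>) (\<Phi> T) T \<alpha>1 \<alpha>2) \<le> K * T powr (1 - \<epsilon>)"
    by (intro exI[of _ "1/2"] conjI allI impI exI[of _ K]) auto
next
  fix \<theta> :: real and \<nu>
  assume \<theta>: "0 < \<theta> \<and> \<theta> < 1 / (4 * real k)" and \<nu>: "\<nu> \<in> {3..k}"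
  have "1 / (4 * real k) \<le> 1 / (2 * real k)" using assms(1) by (simp add: field_simps)
  then obtain K where K: "\<forall>\<^sub>F T in at_top. \<forall>as bs. length as = 2 \<and> length bs = 2 \<and>
      (\<forall>a\<in>set as \<union> set bs. norm a \<le> 1/4) \<longrightarrow>
      norm (LBINT t. twisted_product k \<nu> P (T powr \<theta>) as bs (Complex (1/2) t) * of_real (\<Phi> T (t / T)))
        \<le> K * T powr (1/2)"
    using second_twisted_moment_bound[OF assms(2), of \<nu> k \<theta> P] \<theta> \<nu> by force
  have "\<forall>\<^sub>F T in at_top. \<forall>\<alpha>1 \<alpha>2 \<alpha>3 \<alpha>4. norm \<alpha>1 \<le> c / ln T \<and> norm \<alpha>2 \<le> c / ln T \<and>
      norm \<alpha>3 \<le> c / ln T \<and> norm \<alpha>4 \<le> c / ln T \<longrightarrow>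
      norm (moment_J k \<nu> P (T powr \<theta>) (\<Phi> T) T \<alpha>1 \<alpha>2 \<alpha>3 \<alpha>4) \<le> K * T powr (1 - 1/2)" for c
    using K eventually_shift_small[of c]
  proof eventually_elim
    case (elim T)
    show ?case
    proof (intro allI impI)
      fix \<alpha>1 \<alpha>2 \<alpha>3 \<alpha>4 :: complex
      assume "norm \<alpha>1 \<le> c / ln T \<and> norm \<alpha>2 \<le> c / ln T \<and> norm \<alpha>3 \<le> c / ln T \<and> norm \<alpha>4 \<le> c / ln T"
      then have small: "norm \<alpha>1 \<le> 1/4" "norm \<alpha>2 \<le> 1/4" "norm \<alpha>3 \<le> 1/4" "norm \<alpha>4 \<le> 1/4"
        using elim(2) by linarith+
      \<comment> \<open>The shifts attached to \<open>+ \<i> * t\<close> form the first list, those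
        attached to \<open>- \<i> * t\<close> the second.\<close>
      have "moment_J k \<nu> P (T powr \<theta>) (\<Phi> T) T \<alpha>1 \<alpha>2 \<alpha>3 \<alpha>4 =
          (LBINT t. twisted_product k \<nu> P (T powr \<theta>) [\<alpha>1, \<alpha>2] [\<alpha>3, \<alpha>4] (Complex (1/2) t) * of_real (\<Phi> T (t / T)))"
        using \<nu> by (simp add: moment_J_def twisted_product_critical_line mult.assoc)
      with elim(1)[rule_format, of "[\<alpha>1, \<alpha>2]" "[\<alpha>3, \<alpha>4]"] small
      show "norm (moment_J k \<nu> P (T powr \<theta>) (\<Phi> T) T \<alpha>1 \<alpha>2 \<alpha>3 \<alpha>4) \<le> K * T powr (1 - 1/2)" by simp
    qed
  qed
  then show "\<exists>\<epsilon>>0. \<forall>c>0. \<exists>K. \<forall>\<^sub>F T in at_top. \<forall>\<alpha>1 \<alpha>2 \<alpha>3 \<alpha>4.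
      norm \<alpha>1 \<le> c / ln T \<and> norm \<alpha>2 \<le> c / ln T \<and> norm \<alpha>3 \<le> c / ln T \<and> norm \<alpha>4 \<le> c / ln T \<longrightarrow>
      norm (moment_J k \<nu> P (T powr \<theta>) (\<Phi> T) T \<alpha>1 \<alpha>2 \<alpha>3 \<alpha>4) \<le> K * T powr (1 - \<epsilon>)"
    by (intro exI[of _ "1/2"] conjI allI impI exI[of _ K]) auto
qed

end
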